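(* Let $\widetilde{H}$ be the affine Hecke algebra of type $C_2$ with $q^2\neq\pm1$. Let $t\in T$ be a weight with $t|_Q=t_{1,q^2}$ and let $w_0$ be the longest element of $W_0$. Let $\mathbb{C}_{1,q^2}=\mathbb{C}v_t$ and $\mathbb{C}_{1,q^{-2}}=\mathbb{C}v_{w_0t}$ be the $1$-dimensional $\widetilde{H}_{\{2\}}$-modules given by $T_2v_t=qv_t$, $X^\lambda v_t=t(X^\lambda)v_t$, and $T_2v_{w_0t}=-q^{-1}v_{w_0t}$, $X^\lambda v_{w_0t}=(w_0t)(X^\lambda)v_{w_0t}$, and let $M=\widetilde{H}\otimes_{\widetilde{H}_{\{2\}}}\mathbb{C}_{1,q^2}$ and $N=\widetilde{H}\otimes_{\widetilde{H}_{\{2\}}}\mathbb{C}_{1,q^{-2}}$. Then $M_{s_1s_2t}$ is a submodule of $M$ and $M/M_{s_1s_2t}$ is irreducible. Similarly, $N_{s_2t}$ is a submodule of $N$ and $N/N_{s_2t}$ is irreducible.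
   Context: The type $C_2$ root system has simple roots $\alpha_1,\alpha_2$ with $\langle\alpha_1,\alpha_2^\vee\rangle=-1$, $\langle\alpha_2,\alpha_1^\vee\rangle=-2$; $s_i\lambda=\lambda-\langle\lambda,\alpha_i^\vee\rangle\alpha_i$, and $W_0=\langle s_1,s_2\rangle$ with longest element $w_0=s_1s_2s_1s_2$. Fundamental weights: $\omega_1=\alpha_1+\frac12\alpha_2$, $\omega_2=\alpha_1+\alpha_2$; $P=\mathbb{Z}\omega_1+\mathbb{Z}\omega_2$, $Q=\mathbb{Z}\alpha_1+\mathbb{Z}\alpha_2$. $X=\{X^\lambda\mid\lambda\in P\}$, $X^\lambda X^\mu=X^{\lambda+\mu}$. For $q\in\mathbb{C}^\times$, $\widetilde{H}$ is the $\mathbb{C}$-algebra generated by $T_1,T_2$ and $X^\lambda$ ($\lambda\in P$), with the group algebra $\mathbb{C}[X]$ a subalgebra, subject to $T_i^2=(q-q^{-1})T_i+1$, $T_1T_2T_1T_2=T_2T_1T_2T_1$, and $X^\lambda T_i=T_iX^{s_i\lambda}+(q-q^{-1})\frac{X^\lambda-X^{s_i\lambda}}{1-X^{-\alpha_i}}$. $\widetilde{H}_{\{i\}}$ is the subalgebra generated by $T_i$ and $\mathbb{C}[X]$. Weights are elements of $T=\mathrm{Hom}(X,\mathbb{C}^\times)$, with $W_0$-action $(wt)(X^\lambda)=t(X^{w^{-1}\lambda})$. For $t\in T$, $t|_Q$ denotes its restriction to $\{X^\lambda\mid\lambda\in Q\}$, and $t_{z,w}$ is the character of $\{X^\lambda\mid\lambda\in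 Q\}$ with $X^{\alpha_1}\mapsto z$, $X^{\alpha_2}\mapsto w$. For a finite-dimensional $\widetilde{H}$-module $M$, $M_t=\{m\mid X^\lambda m=t(X^\lambda)m\ \forall\lambda\in P\}$. *)

theory Defs
  imports Complex_Main "HOL-Library.Poly_Mapping" "HOL-Library.Product_Plus" "HOL-Algebra.Algebra"
    "HOL-Algebra.Algebraic_Closure_Type"
begin

section \<open>The root system of type \<open>C\<^sub>2\<close>\<close>

text \<open>The pair \<open>(a, b)\<close> stands for the weight \<open>a \<omega>\<^sub>1 + b \<omega>\<^sub>2\<close>, so that the weight lattice \<open>P\<close> is the
  whole type and the pairing with the \<open>i\<close>-th simple coroot is the \<open>i\<close>-th coordinate.\<close>

type_synonym weight = "int \<times> int"

datatype node = Node1 | Node2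

fun coroot_pairing :: "weight \<Rightarrow> node \<Rightarrow> int" where
  "coroot_pairing (a, b) Node1 = a"
| "coroot_pairing (a, b) Node2 = b"

definition scale :: "int \<Rightarrow> weight \<Rightarrow> weight" where
  "scale n \<nu> = (n * fst \<nu>, n * snd \<nu>)"

fun simple_root :: "node \<Rightarrow> weight" where
  "simple_root Node1 = (2, -1)"
| "simple_root Node2 = (-2, 2)"

lemma cartan_matrix:
  "coroot_pairing (simple_root Node1) Node1 = 2" "coroot_pairing (simple_root Node1) Node2 = -1"
  "coroot_pairing (simple_root Node2) Node1 = -2" "coroot_pairing (simple_root Node2) Node2 = 2"
  by simp_all

text \<open>\<open>\<omega>\<^sub>1 = \<alpha>\<^sub>1 + \<alpha>\<^sub>2 / 2\<close> and \<open>\<omega>\<^sub>2 = \<alpha>\<^sub>1 + \<alpha>\<^sub>2\<close>:\<close>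

lemma fundamental_weights:
  "scale 2 (1, 0) = scale 2 (simple_root Node1) + simple_root Node2"
  "(0, 1) = simple_root Node1 + simple_root Node2"
  by (simp_all add: scale_def)

definition simple_refl :: "node \<Rightarrow> weight \<Rightarrow> weight" where
  "simple_refl i \<nu> = \<nu> - scale (coroot_pairing \<nu> i) (simple_root i)"

definition longest_elt :: "weight \<Rightarrow> weight" where
  "longest_elt = simple_refl Node1 \<circ> simple_refl Node2 \<circ> simple_refl Node1 \<circ> simple_refl Node2"

lemma simple_refl_simple_refl [simp]: "simple_refl i (simple_refl i \<nu>) = \<nu>"
  by (cases i; cases \<nu>) (simp_all add: simple_refl_def scale_def)

text \<open>The word \<open>s\<^sub>1 s\<^sub>2 s\<^sub>1 s\<^sub>2\<close> sends every positive root to a negative one.\<close>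

lemma longest_elt_uminus: "longest_elt \<nu> = - \<nu>"
  by (cases \<nu>) (simp add: longest_elt_def simple_refl_def scale_def)

text \<open>The characters in \<open>T = Hom(X, \<complex>\<^sup>\<times>)\<close>, where \<open>t \<nu>\<close> is the value at \<open>X\<^sup>\<nu>\<close>.\<close>

definition characters :: "(weight \<Rightarrow> complex) set" where
  "characters = {t. (\<forall>\<nu>. t \<nu> \<noteq> 0) \<and> (\<forall>\<nu> \<mu>. t (\<nu> + \<mu>) = t \<nu> * t \<mu>)}"

definition weyl_act :: "(weight \<Rightarrow> weight) \<Rightarrow> (weight \<Rightarrow> complex) \<Rightarrow> weight \<Rightarrow> complex" where
  "weyl_act w t = (\<lambda>\<nu>. t (inv_into UNIV w \<nu>))"

text \<open>\<open>t|\<^sub>Q = t\<^bsub>z,w\<^esub>\<close>:\<close>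

definition restricts_to :: "(weight \<Rightarrow> complex) \<Rightarrow> complex \<Rightarrow> complex \<Rightarrow> bool" where
  "restricts_to t z w \<longleftrightarrow>
     (\<forall>m n. t (scale m (simple_root Node1) + scale n (simple_root Node2)) = z powi m * w powi n)"

section \<open>The affine Hecke algebra\<close>

datatype generator = GenT node | GenX weight

text \<open>Words form a monoid under concatenation, written additively because
  \<^typ>\<open>'a \<Rightarrow>\<^sub>0 'b\<close> takes its convolution product from an additive monoid of exponents.
  The free algebra is the monoid algebra of words.\<close>

instantiation list :: (type) monoid_add
begin

definition zero_list :: "'a list" where "zero_list = []"

definition plus_list :: "'a list \<Rightarrow> 'a list \<Rightarrow> 'a list" where "plus_list = (@)"

instance
  by standard (simp_all add: zero_list_def plus_list_def)

end

type_synonym free_alg = "generator list \<Rightarrow>\<^sub>0 complex"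

definition cst :: "complex \<Rightarrow> free_alg" where
  "cst c = Poly_Mapping.single [] c"

definition gen :: "generator \<Rightarrow> free_alg" where
  "gen g = Poly_Mapping.single [g] 1"

abbreviation gT :: "node \<Rightarrow> free_alg" where "gT i \<equiv> gen (GenT i)"
abbreviation gX :: "weight \<Rightarrow> free_alg" where "gX \<nu> \<equiv> gen (GenX \<nu>)"

text \<open>The group algebra \<open>\<complex>[X]\<close>, its basis \<open>X\<^sup>\<nu>\<close>, and its linear map to the free algebra.\<close>

type_synonym grp_alg = "weight \<Rightarrow>\<^sub>0 complex"

definition mon :: "weight \<Rightarrow> grp_alg" where
  "mon \<nu> = Poly_Mapping.single \<nu> 1"

definition emb :: "grp_alg \<Rightarrow> free_alg" where
  "emb f = (\<Sum>\<nu>\<in>Poly_Mapping.keys f. cst (Poly_Mapping.lookup f \<nu>) * gX \<nu>)"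

text \<open>In the last family, \<open>f\<close> is the quotient \<open>(X\<^sup>\<nu> - X\<^bsup>s\<^sub>i\<nu>\<^esup>) / (1 - X\<^bsup>-\<alpha>\<^sub>i\<^esup>)\<close>. It exists in \<open>\<complex>[X]\<close> and is
  unique, because \<open>1 - X\<^bsup>-\<alpha>\<^sub>i\<^esup>\<close> is not a zero divisor there.\<close>

definition hecke_relations :: "complex \<Rightarrow> free_alg set" where
  "hecke_relations q =
     {gX 0 - 1}
   \<union> {gX \<nu> * gX \<mu> - gX (\<nu> + \<mu>) | \<nu> \<mu>. True}
   \<union> {gT i * gT i - (cst (q - inverse q) * gT i + 1) | i. True}
   \<union> {gT Node1 * gT Node2 * gT Node1 * gT Node2 - gT Node2 * gT Node1 * gT Node2 * gT Node1}
   \<union> {gX \<nu> * gT i - (gT i * gX (simple_refl i \<nu>) + cst (q - inverse q) * emb f) | i \<nu> f.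
        f * (1 - mon (- simple_root i)) = mon \<nu> - mon (simple_refl i \<nu>)}"

definition hecke_ideal :: "complex \<Rightarrow> free_alg set" where
  "hecke_ideal q = Idl\<^bsub>ring_of_type_algebra\<^esub> (hecke_relations q)"

definition hecke :: "complex \<Rightarrow> free_alg set ring" where
  "hecke q = ring_of_type_algebra Quot hecke_ideal q"

definition cls :: "complex \<Rightarrow> free_alg \<Rightarrow> free_alg set" where
  "cls q a = hecke_ideal q +>\<^bsub>ring_of_type_algebra\<^esub> a"

abbreviation hT :: "complex \<Rightarrow> node \<Rightarrow> free_alg set" where "hT q i \<equiv> cls q (gT i)"
abbreviation hX :: "complex \<Rightarrow> weight \<Rightarrow> free_alg set" where "hX q \<nu> \<equiv> cls q (gX \<nu>)"
abbreviation hC :: "complex \<Rightarrow> complex \<Rightarrow> free_alg set" where "hC q c \<equiv> cls q (cst c)"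

text \<open>The \<open>\<complex>\<close>-subalgebra generated by \<open>T\<^sub>i\<close> and \<open>\<complex>[X]\<close>. The scalars are among the ring generators.\<close>

definition parabolic_carrier :: "complex \<Rightarrow> node \<Rightarrow> free_alg set set" where
  "parabolic_carrier q i = generate_ring (hecke q) ({hT q i} \<union> range (hX q) \<union> range (hC q))"

definition parabolic :: "complex \<Rightarrow> node \<Rightarrow> free_alg set ring" where
  "parabolic q i = (hecke q)\<lparr>carrier := parabolic_carrier q i\<rparr>"

lemma ring_of_type_algebra_ring: "ring (ring_of_type_algebra :: 'a::ring_1 ring)"
proof -
  have "\<exists>y. x + y = 0" for x :: 'a
    using add.right_inverse by blast
  thus ?thesis
    unfolding ring_of_type_algebra_def using add.right_inverse
    by unfold_locales (auto simp: algebra_simps Units_def)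
qed

lemma ideal_hecke_ideal: "ideal (hecke_ideal q) ring_of_type_algebra"
  unfolding hecke_ideal_def
  by (rule ring.genideal_ideal[OF ring_of_type_algebra_ring]) (simp add: ring_of_type_algebra_def)

lemma ring_hecke: "ring (hecke q)"
  unfolding hecke_def by (rule ideal.quotient_is_ring[OF ideal_hecke_ideal])

lemma cls_carrier: "cls q a \<in> carrier (hecke q)"
  unfolding hecke_def cls_def FactRing_def A_RCOSETS_def RCOSETS_def a_r_coset_def
  by (auto simp: ring_of_type_algebra_def)

lemma subring_parabolic: "subring (parabolic_carrier q i) (hecke q)"
  unfolding parabolic_carrier_def
  by (rule ring.generate_ring_is_subring[OF ring_hecke]) (auto simp: cls_carrier)

lemma ring_parabolic: "ring (parabolic q i)"
  unfolding parabolic_def by (rule ring.subring_is_ring[OF ring_hecke subring_parabolic])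


section \<open>Modules over noncommutative rings\<close>

text \<open>The library locale \<^locale>\<open>module\<close> requires a commutative ring of scalars.\<close>

locale left_module = R?: ring R + M?: abelian_group M
  for R :: "('a, 'd) ring_scheme" (structure) and M :: "('a, 'b, 'c) module_scheme" (structure) +
  assumes smult_closed [simp, intro]:
      "\<lbrakk>a \<in> carrier R; x \<in> carrier M\<rbrakk> \<Longrightarrow> a \<odot>\<^bsub>M\<^esub> x \<in> carrier M"
    and smult_l_distr:
      "\<lbrakk>a \<in> carrier R; b \<in> carrier R; x \<in> carrier M\<rbrakk> \<Longrightarrow>
        (a \<oplus>\<^bsub>R\<^esub> b) \<odot>\<^bsub>M\<^esub> x = a \<odot>\<^bsub>M\<^esub> x \<oplus>\<^bsub>M\<^esub> b \<odot>\<^bsub>M\<^esub> x"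
    and smult_r_distr:
      "\<lbrakk>a \<in> carrier R; x \<in> carrier M; y \<in> carrier M\<rbrakk> \<Longrightarrow>
        a \<odot>\<^bsub>M\<^esub> (x \<oplus>\<^bsub>M\<^esub> y) = a \<odot>\<^bsub>M\<^esub> x \<oplus>\<^bsub>M\<^esub> a \<odot>\<^bsub>M\<^esub> y"
    and smult_assoc1:
      "\<lbrakk>a \<in> carrier R; b \<in> carrier R; x \<in> carrier M\<rbrakk> \<Longrightarrow>
        (a \<otimes>\<^bsub>R\<^esub> b) \<odot>\<^bsub>M\<^esub> x = a \<odot>\<^bsub>M\<^esub> (b \<odot>\<^bsub>M\<^esub> x)"
    and smult_one [simp]: "x \<in> carrier M \<Longrightarrow> \<one>\<^bsub>R\<^esub> \<odot>\<^bsub>M\<^esub> x = x"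

text \<open>Module records extend ring records; the fields \<open>mult\<close> and \<open>one\<close> are not used.\<close>

definition quot_module :: "('a, 'b, 'c) module_scheme \<Rightarrow> 'b set \<Rightarrow> ('a, 'b set) module" where
  "quot_module M N =
     \<lparr>carrier = a_rcosets\<^bsub>M\<^esub> N, monoid.mult = undefined, one = undefined,
      ring.zero = N, add = set_add M,
      module.smult = (\<lambda>r A. \<Union>x\<in>A. N +>\<^bsub>M\<^esub> (r \<odot>\<^bsub>M\<^esub> x))\<rparr>"

lemma left_module_quot_moduleI:
  fixes R (structure) and M :: "('a, 'b, 'c) module_scheme" (structure)
  assumes "ring R" "abelian_group M" "subgroup N (add_monoid M)"
    and closed: "\<And>r x. r \<in> carrier R \<Longrightarrow> x \<in> carrier M \<Longrightarrow> r \<odot>\<^bsub>M\<^esub> x \<in> carrier M"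
    and stable: "\<And>r x. r \<in> carrier R \<Longrightarrow> x \<in> N \<Longrightarrow> r \<odot>\<^bsub>M\<^esub> x \<in> N"
    and l_distr: "\<And>r s x. \<lbrakk>r \<in> carrier R; s \<in> carrier R; x \<in> carrier M\<rbrakk> \<Longrightarrow>
        N +>\<^bsub>M\<^esub> ((r \<oplus>\<^bsub>R\<^esub> s) \<odot>\<^bsub>M\<^esub> x) = N +>\<^bsub>M\<^esub> (r \<odot>\<^bsub>M\<^esub> x \<oplus>\<^bsub>M\<^esub> s \<odot>\<^bsub>M\<^esub> x)"
    and r_distr: "\<And>r x y. \<lbrakk>r \<in> carrier R; x \<in> carrier M; y \<in> carrier M\<rbrakk> \<Longrightarrow>
        r \<odot>\<^bsub>M\<^esub> (x \<oplus>\<^bsub>M\<^esub> y) = r \<odot>\<^bsub>M\<^esub> x \<oplus>\<^bsub>M\<^esub> r \<odot>\<^bsub>M\<^esub> y"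
    and assoc: "\<And>r s x. \<lbrakk>r \<in> carrier R; s \<in> carrier R; x \<in> carrier M\<rbrakk> \<Longrightarrow>
        (r \<otimes>\<^bsub>R\<^esub> s) \<odot>\<^bsub>M\<^esub> x = r \<odot>\<^bsub>M\<^esub> (s \<odot>\<^bsub>M\<^esub> x)"
    and one: "\<And>x. x \<in> carrier M \<Longrightarrow> \<one>\<^bsub>R\<^esub> \<odot>\<^bsub>M\<^esub> x = x"
  shows "left_module R (quot_module M N)"
    and "\<And>r x. r \<in> carrier R \<Longrightarrow> x \<in> carrier M \<Longrightarrow>
      r \<odot>\<^bsub>quot_module M N\<^esub> (N +>\<^bsub>M\<^esub> x) = N +>\<^bsub>M\<^esub> (r \<odot>\<^bsub>M\<^esub> x)"
proof -
  interpret R: ring R by fact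
  interpret M: abelian_group M by fact
  interpret NS: abelian_subgroup N M
    by (rule abelian_subgroupI3) (auto intro: additive_subgroup.intro assms)
  have car: "carrier (quot_module M N) = a_rcosets\<^bsub>M\<^esub> N"
    and add: "add (quot_module M N) = set_add M"
    and smult: "module.smult (quot_module M N) r A = (\<Union>x\<in>A. N +>\<^bsub>M\<^esub> (r \<odot>\<^bsub>M\<^esub> x))" for r A
    by (simp_all add: quot_module_def)
  have rep: "\<exists>x\<in>carrier M. A = N +>\<^bsub>M\<^esub> x" if "A \<in> a_rcosets\<^bsub>M\<^esub> N" for A
    using that by (auto simp: A_RCOSETS_def RCOSETS_def a_r_coset_def)
  show sm: "r \<odot>\<^bsub>quot_module M N\<^esub> (N +>\<^bsub>M\<^esub> x) = N +>\<^bsub>M\<^esub> (r \<odot>\<^bsub>M\<^esub> x)"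
    if r: "r \<in> carrier R" and x: "x \<in> carrier M" for r x
  proof -
    have "N +>\<^bsub>M\<^esub> (r \<odot>\<^bsub>M\<^esub> y) = N +>\<^bsub>M\<^esub> (r \<odot>\<^bsub>M\<^esub> x)" if y: "y \<in> N +>\<^bsub>M\<^esub> x" for y
    proof -
      from y obtain n where n: "n \<in> N" "y = n \<oplus>\<^bsub>M\<^esub> x"
        by (auto simp: a_r_coset_def r_coset_def)
      have nc: "n \<in> carrier M" using n NS.a_subset by auto
      have "r \<odot>\<^bsub>M\<^esub> y = r \<odot>\<^bsub>M\<^esub> n \<oplus>\<^bsub>M\<^esub> r \<odot>\<^bsub>M\<^esub> x"
        using n nc r x by (simp add: r_distr)
      hence "r \<odot>\<^bsub>M\<^esub> y \<in> N +>\<^bsub>M\<^esub> (r \<odot>\<^bsub>M\<^esub> x)"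
        using n r stable by (auto simp: a_r_coset_def r_coset_def)
      thus ?thesis using NS.a_repr_independence' closed r x by metis
    qed
    moreover have "x \<in> N +>\<^bsub>M\<^esub> x" using NS.a_rcos_self x by blast
    ultimately show ?thesis unfolding smult by blast
  qed
  have sum: "(N +>\<^bsub>M\<^esub> x) <+>\<^bsub>M\<^esub> (N +>\<^bsub>M\<^esub> y) = N +>\<^bsub>M\<^esub> (x \<oplus>\<^bsub>M\<^esub> y)"
    if "x \<in> carrier M" "y \<in> carrier M" for x y
    using NS.a_rcos_sum that by blast
  have cosI: "N +>\<^bsub>M\<^esub> x \<in> a_rcosets\<^bsub>M\<^esub> N" if "x \<in> carrier M" for x
    using that M.a_rcosetsI NS.a_subset by auto
  have zero: "\<zero>\<^bsub>quot_module M N\<^esub> = N +>\<^bsub>M\<^esub> \<zero>\<^bsub>M\<^esub>"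
    using M.a_coset_join2[OF M.zero_closed NS.a_subgroup] NS.zero_closed
    by (simp add: quot_module_def)
  have ab: "abelian_group (quot_module M N)"
  proof (rule abelian_groupI, unfold car add zero)
    fix A assume "A \<in> a_rcosets\<^bsub>M\<^esub> N"
    then obtain x where x: "x \<in> carrier M" "A = N +>\<^bsub>M\<^esub> x" using rep by blast
    show "\<exists>B\<in>a_rcosets\<^bsub>M\<^esub> N. B <+>\<^bsub>M\<^esub> A = N +>\<^bsub>M\<^esub> \<zero>\<^bsub>M\<^esub>"
      by (rule bexI[of _ "N +>\<^bsub>M\<^esub> (\<ominus>\<^bsub>M\<^esub> x)"]) (auto simp: x sum cosI M.l_neg)
  qed (auto dest!: rep simp: sum cosI M.a_ac)
  show "left_module R (quot_module M N)"
  proof (intro left_module.intro left_module_axioms.intro ab \<open>ring R\<close>)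
  qed (auto simp: car add dest!: rep simp: sm sum cosI closed l_distr r_distr assoc one)
qed

lemma left_module_quot_module:
  assumes "left_module R M" "submodule N R M"
  shows "left_module R (quot_module M N)"
proof -
  interpret left_module R M by fact
  interpret N: submodule N R M by fact
  show ?thesis
    by (rule left_module_quot_moduleI(1))
      (auto intro: R.ring_axioms M.abelian_group_axioms N.subgroup_axioms
        simp: smult_l_distr smult_r_distr smult_assoc1)
qed

definition irreducible_module :: "('a, 'd) ring_scheme \<Rightarrow> ('a, 'b, 'c) module_scheme \<Rightarrow> bool" where
  "irreducible_module R M \<longleftrightarrow> left_module R M \<and> carrier M \<noteq> {\<zero>\<^bsub>M\<^esub>} \<and>
     (\<forall>N. submodule N R M \<longrightarrow> N = {\<zero>\<^bsub>M\<^esub>} \<or> N = carrier M)"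

text \<open>For a subring \<open>S\<close> of \<open>R\<close> and a left \<open>S\<close>-module \<open>V\<close>, the left \<open>R\<close>-module \<open>R \<otimes>\<^sub>S V\<close>: the free abelian
  group on \<open>R \<times> V\<close> modulo the subgroup generated by the relations of an \<open>S\<close>-balanced biadditive map,
  with action \<open>r (a \<otimes> x) = (r a) \<otimes> x\<close>. The action is additive in \<open>r\<close> only after passing to the quotient,
  so \<open>free_pairs\<close> itself is not a module. When \<open>S\<close> contains the scalars of an algebra \<open>R\<close>, \<open>S\<close>-balanced maps
  are automatically linear over the ground field, so no further relations are needed.\<close>

definition tensor_relations ::
  "('a, 'd) ring_scheme \<Rightarrow> ('a, 'e) ring_scheme \<Rightarrow> ('a, 'b, 'c) module_scheme \<Rightarrow> ('a \<times> 'b \<Rightarrow>\<^sub>0 int) set" where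
  "tensor_relations R S V =
     {frag_of (a \<oplus>\<^bsub>R\<^esub> b, x) - frag_of (a, x) - frag_of (b, x) | a b x.
        a \<in> carrier R \<and> b \<in> carrier R \<and> x \<in> carrier V}
   \<union> {frag_of (a, x \<oplus>\<^bsub>V\<^esub> y) - frag_of (a, x) - frag_of (a, y) | a x y.
        a \<in> carrier R \<and> x \<in> carrier V \<and> y \<in> carrier V}
   \<union> {frag_of (a \<otimes>\<^bsub>R\<^esub> s, x) - frag_of (a, s \<odot>\<^bsub>V\<^esub> x) | a s x.
        a \<in> carrier R \<and> s \<in> carrier S \<and> x \<in> carrier V}"

definition free_pairs ::
  "('a, 'd) ring_scheme \<Rightarrow> ('a, 'b, 'c) module_scheme \<Rightarrow> ('a, 'a \<times> 'b \<Rightarrow>\<^sub>0 int) module" where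
  "free_pairs R V =
     \<lparr>carrier = carrier (free_Abelian_group (carrier R \<times> carrier V)),
      monoid.mult = undefined, one = undefined, ring.zero = 0, add = (+),
      module.smult = (\<lambda>r. frag_extend (\<lambda>(a, x). frag_of (r \<otimes>\<^bsub>R\<^esub> a, x)))\<rparr>"

definition induced_module ::
  "('a, 'd) ring_scheme \<Rightarrow> ('a, 'e) ring_scheme \<Rightarrow> ('a, 'b, 'c) module_scheme \<Rightarrow>
     ('a, ('a \<times> 'b \<Rightarrow>\<^sub>0 int) set) module" where
  "induced_module R S V =
     quot_module (free_pairs R V)
       (generate (free_Abelian_group (carrier R \<times> carrier V)) (tensor_relations R S V))"

lemma left_module_induced_module:
  assumes "ring R" and S: "carrier S \<subseteq> carrier R" and V: "left_module S V"
  shows "left_module R (induced_module R S V)"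
proof -
  interpret R: ring R by fact
  interpret V: left_module S V by fact
  let ?F = "free_pairs R V" and ?G = "free_Abelian_group (carrier R \<times> carrier V)"
  let ?T = "tensor_relations R S V"
  let ?N = "generate ?G ?T"
  interpret G: comm_group ?G by (rule abelian_free_Abelian_group)
  have carG: "carrier ?G = {c. Poly_Mapping.keys c \<subseteq> carrier R \<times> carrier V}"
    by (simp add: free_Abelian_group_def)
  have mF: "carrier ?F = carrier ?G" "x \<oplus>\<^bsub>?F\<^esub> y = x + y" "\<zero>\<^bsub>?F\<^esub> = 0" for x y
    by (simp_all add: free_pairs_def)
  have sF: "r \<odot>\<^bsub>?F\<^esub> x = frag_extend (\<lambda>(a, x). frag_of (r \<otimes>\<^bsub>R\<^esub> a, x)) x" for r x
    by (simp add: free_pairs_def)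
  have mon: "monoid.mult ?G = (+)" "\<one>\<^bsub>?G\<^esub> = 0" by (simp_all add: free_Abelian_group_def)
  have ku: "- x \<in> carrier ?G" "x + y \<in> carrier ?G" "x - y \<in> carrier ?G"
    if "x \<in> carrier ?G" "y \<in> carrier ?G" for x y
    using that keys_add[of x y] keys_diff[of x y] by (auto simp: carG)
  have ab: "abelian_group ?F"
  proof (rule abelian_groupI, unfold mF)
    fix x assume "x \<in> carrier ?G"
    thus "\<exists>y\<in>carrier ?G. y + x = 0" by (intro bexI[of _ "- x"] ku) auto
  qed (auto simp: ku add_ac carG dest: keys_add[THEN subsetD])
  have fo: "frag_of (a, x) \<in> carrier ?G" if "a \<in> carrier R" "x \<in> carrier V" for a x
    using that by (simp add: carG)
  have sub: "?T \<subseteq> carrier ?G"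
    unfolding tensor_relations_def using S by (auto intro!: ku(3) fo)
  have N: "subgroup ?N ?G" by (rule G.generate_is_subgroup[OF sub])
  have closed: "r \<odot>\<^bsub>?F\<^esub> x \<in> carrier ?G" if "r \<in> carrier R" "x \<in> carrier ?G" for r x
    using that keys_frag_extend[of "\<lambda>(a, x). frag_of (r \<otimes>\<^bsub>R\<^esub> a, x)" x]
    by (fastforce simp: carG sF)
  have invG: "inv\<^bsub>?G\<^esub> x = - x" if "x \<in> carrier ?G" for x
    using that by (intro G.inv_equality) (auto simp: carG mon)
  have diffN: "a - b \<in> ?N" if "a \<in> ?N" "b \<in> ?N" for a b
    using subgroup.m_closed[OF N that(1) subgroup.m_inv_closed[OF N that(2)]] that
      subgroup.subset[OF N] by (auto simp: invG mon)
  have sT: "r \<odot>\<^bsub>?F\<^esub> x \<in> ?N" if r: "r \<in> carrier R" and x: "x \<in> ?T" for r x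
  proof -
    consider (add_l) a b v where "x = frag_of (a \<oplus>\<^bsub>R\<^esub> b, v) - frag_of (a, v) - frag_of (b, v)"
        "a \<in> carrier R" "b \<in> carrier R" "v \<in> carrier V"
      | (add_r) a v w where "x = frag_of (a, v \<oplus>\<^bsub>V\<^esub> w) - frag_of (a, v) - frag_of (a, w)"
        "a \<in> carrier R" "v \<in> carrier V" "w \<in> carrier V"
      | (bal) a s v where "x = frag_of (a \<otimes>\<^bsub>R\<^esub> s, v) - frag_of (a, s \<odot>\<^bsub>V\<^esub> v)"
        "a \<in> carrier R" "s \<in> carrier S" "v \<in> carrier V"
      using x unfolding tensor_relations_def by blast
    hence "r \<odot>\<^bsub>?F\<^esub> x \<in> ?T"
    proof cases
      case add_l
      hence "r \<odot>\<^bsub>?F\<^esub> x = frag_of (r \<otimes>\<^bsub>R\<^esub> a \<oplus>\<^bsub>R\<^esub> r \<otimes>\<^bsub>R\<^esub> b, v) - frag_of (r \<otimes>\<^bsub>R\<^esub> a, v) - frag_of (r \<otimes>\<^bsub>R\<^esub> b, v)"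
        using r by (simp add: sF frag_extend_diff R.r_distr)
      thus ?thesis unfolding tensor_relations_def using add_l r by blast
    next
      case add_r
      hence "r \<odot>\<^bsub>?F\<^esub> x = frag_of (r \<otimes>\<^bsub>R\<^esub> a, v \<oplus>\<^bsub>V\<^esub> w) - frag_of (r \<otimes>\<^bsub>R\<^esub> a, v) - frag_of (r \<otimes>\<^bsub>R\<^esub> a, w)"
        by (simp add: sF frag_extend_diff)
      thus ?thesis unfolding tensor_relations_def using add_r r by blast
    next
      case bal
      hence "r \<odot>\<^bsub>?F\<^esub> x = frag_of ((r \<otimes>\<^bsub>R\<^esub> a) \<otimes>\<^bsub>R\<^esub> s, v) - frag_of (r \<otimes>\<^bsub>R\<^esub> a, s \<odot>\<^bsub>V\<^esub> v)"
        using r S by (auto simp: sF frag_extend_diff R.m_assoc)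
      thus ?thesis unfolding tensor_relations_def using bal r by blast
    qed
    thus ?thesis by (rule generate.incl)
  qed
  have stable: "r \<odot>\<^bsub>?F\<^esub> x \<in> ?N" if r: "r \<in> carrier R" and x: "x \<in> ?N" for r x
    using x
  proof (induction rule: generate.induct)
    case one
    show ?case using subgroup.one_closed[OF N] by (simp add: sF mon)
  next
    case (inv h)
    have "inv\<^bsub>?G\<^esub> h = 0 - h" using inv sub by (auto simp: invG)
    thus ?case using sT[OF r inv] diffN[of 0 "r \<odot>\<^bsub>?F\<^esub> h"] subgroup.one_closed[OF N]
      by (simp add: sF frag_extend_diff frag_extend_minus mon)
  next
    case (eng a b)
    thus ?case using subgroup.m_closed[OF N] by (simp add: sF mon frag_extend_add)
  qed (use sT r in blast)
  have one: "\<one>\<^bsub>R\<^esub> \<odot>\<^bsub>?F\<^esub> x = x" if "x \<in> carrier ?G" for x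
  proof -
    have "\<one>\<^bsub>R\<^esub> \<odot>\<^bsub>?F\<^esub> x = frag_extend frag_of x" unfolding sF
      using that by (intro frag_extend_eq) (auto simp: carG)
    thus ?thesis using frag_expansion by metis
  qed
  have assoc: "(r \<otimes>\<^bsub>R\<^esub> s) \<odot>\<^bsub>?F\<^esub> x = r \<odot>\<^bsub>?F\<^esub> (s \<odot>\<^bsub>?F\<^esub> x)"
    if rs: "r \<in> carrier R" "s \<in> carrier R" and x: "x \<in> carrier ?G" for r s x
    using x[unfolded carG, simplified]
    by (induction x rule: frag_induction) (auto simp: sF frag_extend_diff rs R.m_assoc)
  have l_distr: "(r \<oplus>\<^bsub>R\<^esub> s) \<odot>\<^bsub>?F\<^esub> x - (r \<odot>\<^bsub>?F\<^esub> x + s \<odot>\<^bsub>?F\<^esub> x) \<in> ?N"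
    if rs: "r \<in> carrier R" "s \<in> carrier R" and x: "x \<in> carrier ?G" for r s x
    using x[unfolded carG, simplified]
  proof (induction x rule: frag_induction)
    case zero
    show ?case using subgroup.one_closed[OF N] by (simp add: sF mon)
  next
    case (one p)
    obtain a v where p: "p = (a, v)" "a \<in> carrier R" "v \<in> carrier V" using one by auto
    have "frag_of (r \<otimes>\<^bsub>R\<^esub> a \<oplus>\<^bsub>R\<^esub> s \<otimes>\<^bsub>R\<^esub> a, v) - frag_of (r \<otimes>\<^bsub>R\<^esub> a, v) - frag_of (s \<otimes>\<^bsub>R\<^esub> a, v) \<in> ?T"
      unfolding tensor_relations_def using p rs by blast
    hence "frag_of (r \<otimes>\<^bsub>R\<^esub> a \<oplus>\<^bsub>R\<^esub> s \<otimes>\<^bsub>R\<^esub> a, v) - frag_of (r \<otimes>\<^bsub>R\<^esub> a, v) - frag_of (s \<otimes>\<^bsub>R\<^esub> a, v) \<in> ?N"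
      by (rule generate.incl)
    thus ?case using p rs by (simp add: sF R.l_distr diff_diff_add)
  next
    case (diff a b)
    from diffN[OF this] show ?case by (simp add: sF frag_extend_diff algebra_simps)
  qed
  have invF: "inv\<^bsub>add_monoid ?F\<^esub> x = - x" if "x \<in> carrier ?G" for x
    using abelian_group.minus_equality[OF ab, of "- x" x] that ku[OF that that]
    by (simp add: mF a_inv_def)
  have NF: "subgroup ?N (add_monoid ?F)"
  proof (rule subgroup.intro)
    fix x assume x: "x \<in> ?N"
    have "- x \<in> ?N" using diffN[of 0 x] x subgroup.one_closed[OF N] by (simp add: mon)
    thus "inv\<^bsub>add_monoid ?F\<^esub> x \<in> ?N"
      using invF subgroup.subset[OF N] x by auto
  qed (use subgroup.subset[OF N] subgroup.one_closed[OF N] subgroup.m_closed[OF N] in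
      \<open>auto simp: mF mon\<close>)
  show ?thesis unfolding induced_module_def
  proof (rule left_module_quot_moduleI(1)[OF \<open>ring R\<close> ab NF], unfold mF)
    fix r s x assume rs: "r \<in> carrier R" "s \<in> carrier R" and x: "x \<in> carrier ?G"
    let ?y = "r \<odot>\<^bsub>?F\<^esub> x + s \<odot>\<^bsub>?F\<^esub> x"
    have "?y \<in> carrier ?F" using abelian_monoid.a_closed[of ?F] ab closed rs x
      by (metis abelian_group.axioms(1) mF(1,2))
    moreover have "(r \<oplus>\<^bsub>R\<^esub> s) \<odot>\<^bsub>?F\<^esub> x \<in> ?N +>\<^bsub>?F\<^esub> ?y"
      unfolding a_r_coset_def r_coset_def
      using l_distr[OF rs x] by (auto simp: mF intro!: bexI[of _ "(r \<oplus>\<^bsub>R\<^esub> s) \<odot>\<^bsub>?F\<^esub> x - ?y"])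
    ultimately show "?N +>\<^bsub>?F\<^esub> ((r \<oplus>\<^bsub>R\<^esub> s) \<odot>\<^bsub>?F\<^esub> x) = ?N +>\<^bsub>?F\<^esub> ?y"
      using abelian_group.a_repr_independence[OF ab _ _ NF] by metis
  qed (simp_all only: closed stable assoc one, simp add: sF frag_extend_add)
qed

section \<open>Modules over the affine Hecke algebra\<close>

definition weight_space ::
  "complex \<Rightarrow> (free_alg set, 'b, 'c) module_scheme \<Rightarrow> (weight \<Rightarrow> complex) \<Rightarrow> 'b set" where
  "weight_space q M t =
     {m \<in> carrier M. \<forall>\<nu>. hX q \<nu> \<odot>\<^bsub>M\<^esub> m = hC q (t \<nu>) \<odot>\<^bsub>M\<^esub> m}"

text \<open>\<open>V = \<complex>v\<close> is a one-dimensional module over the subalgebra generated by \<open>T\<^sub>i\<close> and \<open>\<complex>[X]\<close>, with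
  \<open>T\<^sub>i v = c v\<close> and \<open>X\<^sup>\<nu> v = t(X\<^sup>\<nu>) v\<close>.\<close>

definition is_line_module ::
  "complex \<Rightarrow> node \<Rightarrow> (free_alg set, 'b, 'c) module_scheme \<Rightarrow> 'b \<Rightarrow> complex \<Rightarrow>
     (weight \<Rightarrow> complex) \<Rightarrow> bool" where
  "is_line_module q i V v c t \<longleftrightarrow>
     left_module (parabolic q i) V \<and> v \<in> carrier V \<and> v \<noteq> \<zero>\<^bsub>V\<^esub> \<and>
     carrier V = {hC q z \<odot>\<^bsub>V\<^esub> v | z. True} \<and>
     hT q i \<odot>\<^bsub>V\<^esub> v = hC q c \<odot>\<^bsub>V\<^esub> v \<and>
     (\<forall>\<nu>. hX q \<nu> \<odot>\<^bsub>V\<^esub> v = hC q (t \<nu>) \<odot>\<^bsub>V\<^esub> v)"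

end

theory Submission
  imports Defs
begin

text \<open>
  Write \<open>\<delta> = q - q\<^sup>-\<^sup>1\<close> and describe a weight by its values at \<open>(\<alpha>\<^sub>1, \<alpha>\<^sub>2)\<close>. Then \<open>t = s\<^sub>1t\<close> is
  \<open>(1, q\<^sup>2)\<close>, while \<open>s\<^sub>2t = (q\<^sup>2, q\<^sup>-\<^sup>2)\<close> and \<open>s\<^sub>1s\<^sub>2t = (q\<^sup>-\<^sup>2, q\<^sup>2)\<close>; these three are distinct because
  \<open>q\<^sup>4 \<noteq> 1\<close>. The four words \<open>1, T\<^sub>1, T\<^sub>2T\<^sub>1, T\<^sub>1T\<^sub>2T\<^sub>1\<close> applied to \<open>v\<close> span \<open>M\<close>. Replacing the words by
  intertwining operators gives a basis adapted to the weights,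
  \<open>v\<close>, \<open>v' = T\<^sub>1v\<close>, \<open>u = T\<^sub>2v' - qv' - 2v\<close> and \<open>w = T\<^sub>1u - qu\<close>, in which for \<open>\<nu> = m\<omega>\<^sub>1 + n\<omega>\<^sub>2\<close>

  \<^item> \<open>T\<^sub>1\<close> maps \<open>v \<mapsto> v'\<close>, \<open>v' \<mapsto> \<delta>v' + v\<close>, \<open>u \<mapsto> qu + w\<close>, \<open>w \<mapsto> -q\<^sup>-\<^sup>1w\<close>;
  \<^item> \<open>T\<^sub>2\<close> maps \<open>v \<mapsto> qv\<close>, \<open>v' \<mapsto> u + qv' + 2v\<close>, \<open>u \<mapsto> -q\<^sup>-\<^sup>1u - 2(q + q\<^sup>-\<^sup>1)v\<close>, \<open>w \<mapsto> qw\<close>;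
  \<^item> \<open>X\<^sup>\<nu>\<close> maps \<open>v \<mapsto> t(\<nu>)v\<close>, \<open>v' \<mapsto> t(\<nu>)(v' + m\<delta>v)\<close>, \<open>u \<mapsto> (s\<^sub>2t)(\<nu>)u\<close>, \<open>w \<mapsto> (s\<^sub>1s\<^sub>2t)(\<nu>)w\<close>.

  So \<open>\<complex>w\<close> is stable, and it is the weight space of \<open>s\<^sub>1s\<^sub>2t\<close>. In the quotient, the operator \<open>X\<^bsup>\<alpha>\<^sub>1\<^esup> - 1\<close>
  is invertible on \<open>u\<close> and is nilpotent on the span of \<open>v, v'\<close>, where it sends \<open>v'\<close> to \<open>2\<delta>v\<close>. As
  \<open>\<delta> \<noteq> 0\<close>, every nonzero submodule therefore contains \<open>u\<close> or \<open>v\<close>. If it contains \<open>u\<close>, then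
  \<open>T\<^sub>2u\<close> yields \<open>v\<close>, because \<open>q + q\<^sup>-\<^sup>1 \<noteq> 0\<close>; and \<open>v\<close> generates everything.

  Computations with cosets in \<open>M\<close> are avoided: the formulas define a representation on \<open>\<complex>\<^sup>4\<close>
  (\<open>rep4\<close>, with \<open>rep4_relations\<close>), and the universal property of the tensor product
  (\<open>induced_hom_exists\<close>) provides a homomorphism \<open>M \<rightarrow> \<complex>\<^sup>4\<close>. It is injective since \<open>M\<close> is spanned by
  the four words (\<open>orbit_eq_pbw\<close>) and their images are linearly independent
  (\<open>coordinates_exist\<close>). Everything else is linear algebra in coordinates (\<open>rep3_irreducible\<close>).

  The assertion on \<open>N\<close> is the assertion on \<open>M\<close> for the parameter \<open>-q\<^sup>-\<^sup>1\<close> and the weight \<open>w\<^sub>0t\<close>: the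
  algebra depends on \<open>q\<close> only through \<open>q - q\<^sup>-\<^sup>1\<close>, which this substitution preserves, and
  \<open>s\<^sub>1s\<^sub>2w\<^sub>0t = s\<^sub>2t\<close> because \<open>s\<^sub>1t = t\<close>.
\<close>

section \<open>Residue classes in the Hecke algebra and actions of the free algebra\<close>

abbreviation FA :: "free_alg ring" where "FA \<equiv> ring_of_type_algebra"

lemma FA_simps: "carrier FA = UNIV" "a \<oplus>\<^bsub>FA\<^esub> b = a + b" "a \<otimes>\<^bsub>FA\<^esub> b = a * b"
  "\<one>\<^bsub>FA\<^esub> = 1" "\<zero>\<^bsub>FA\<^esub> = 0"
  by (simp_all add: ring_of_type_algebra_def)

lemma carrier_hecke: "carrier (hecke q) = range (cls q)"
  unfolding hecke_def cls_def FactRing_def A_RCOSETS_def RCOSETS_def a_r_coset_def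
  by (auto simp: FA_simps)

lemma cls_hom: "cls q \<in> ring_hom FA (hecke q)"
  using ideal.rcos_ring_hom[OF ideal_hecke_ideal] unfolding hecke_def cls_def .

lemma cls_add: "cls q a \<oplus>\<^bsub>hecke q\<^esub> cls q b = cls q (a + b)"
  using ring_hom_add[OF cls_hom] by (simp add: FA_simps)

lemma cls_mult: "cls q a \<otimes>\<^bsub>hecke q\<^esub> cls q b = cls q (a * b)"
  using ring_hom_mult[OF cls_hom] by (simp add: FA_simps)

lemma cls_one: "\<one>\<^bsub>hecke q\<^esub> = cls q 1"
  using ring_hom_one[OF cls_hom] by (simp add: FA_simps)

lemma cls_eq_iff: "cls q a = cls q b \<longleftrightarrow> a - b \<in> hecke_ideal q"
proof -
  interpret ideal "hecke_ideal q" FA by (rule ideal_hecke_ideal)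
  have m: "b \<in> hecke_ideal q +>\<^bsub>FA\<^esub> b" for b by (simp add: a_rcos_self FA_simps)
  have minus: "a \<ominus>\<^bsub>FA\<^esub> b = a - b"
    using minus_equality[of "- b" b] by (simp add: a_minus_def FA_simps)
  show ?thesis
    using a_rcos_module_minus[OF ring_axioms, of b a] a_repr_independence'[of a b] m[of a] minus
    by (auto simp: cls_def FA_simps)
qed

text \<open>Additive statements about finitely supported functions need only be checked on functions supported
  at one point. Multiplicativity and centrality statements in monoid algebras all reduce to this.\<close>

lemma poly_mapping_additive_induct [case_names single add]:
  fixes f :: "'k \<Rightarrow>\<^sub>0 'c::comm_monoid_add"
  assumes single: "\<And>k c. P (Poly_Mapping.single k c)"
    and add: "\<And>f g. P f \<Longrightarrow> P g \<Longrightarrow> P (f + g)"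
  shows "P f"
proof -
  have P0: "P 0" using single[of undefined 0] by simp
  have "P (\<Sum>k\<in>A. Poly_Mapping.single k (h k))" if "finite A" for A h
    using that by induction (auto simp: P0 single intro: add)
  moreover have "(\<Sum>k\<in>Poly_Mapping.keys f. Poly_Mapping.single k (Poly_Mapping.lookup f k)) = f"
    by (rule poly_mapping_eqI) (simp add: lookup_sum lookup_single when_def in_keys_iff)
  ultimately show ?thesis by (metis finite_keys)
qed

lemma cst_add: "cst (a + b) = cst a + cst b"
  by (simp add: cst_def single_add)

lemma cst_mult: "cst a * cst b = cst (a * b)"
  by (simp add: cst_def mult_single plus_list_def)

lemma cst_one [simp]: "cst 1 = 1"
  by (simp add: cst_def zero_list_def flip: single_one)

lemma cls_zero: "cls q 0 = \<zero>\<^bsub>hecke q\<^esub>"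
  using ring_hom_zero[OF cls_hom ring_of_type_algebra_ring ring_hecke] by (simp add: FA_simps)

lemma cst_zero [simp]: "cst 0 = 0"
  by (simp add: cst_def)

text \<open>The scalars are central because the empty word is neutral on both sides.\<close>

lemma cst_commute: "a * cst c = cst c * a"
  by (induction a rule: poly_mapping_additive_induct)
    (simp_all add: cst_def mult_single plus_list_def distrib_left distrib_right mult.commute)

lemma hecke_relation:
  assumes "a - b \<in> hecke_relations q" shows "cls q a = cls q b"
  unfolding cls_eq_iff hecke_ideal_def
  using ring.genideal_self[OF ring_of_type_algebra_ring, of "hecke_relations q"] assms
  by (auto simp: FA_simps)

lemma quadratic_relation: "cls q (gT i * gT i) = cls q (cst (q - inverse q) * gT i + 1)"
  by (rule hecke_relation) (auto simp: hecke_relations_def)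

lemma braid_relation:
  "cls q (gT Node1 * gT Node2 * gT Node1 * gT Node2) = cls q (gT Node2 * gT Node1 * gT Node2 * gT Node1)"
  by (rule hecke_relation) (simp add: hecke_relations_def)

text \<open>A representation of the free algebra is an arbitrary choice of linear operators for the generators.
  If these satisfy the defining relations, it descends to the Hecke algebra.\<close>

locale generator_action = vector_space scale
  for scale :: "complex \<Rightarrow> 'e::ab_group_add \<Rightarrow> 'e" (infixr "*s" 75) +
  fixes act :: "generator \<Rightarrow> 'e \<Rightarrow> 'e"
  assumes act_add: "act g (x + y) = act g x + act g y"
    and act_scale: "act g (c *s x) = c *s act g x"
begin

definition alg_act :: "free_alg \<Rightarrow> 'e \<Rightarrow> 'e" where
  "alg_act a x = (\<Sum>w\<in>Poly_Mapping.keys a. Poly_Mapping.lookup a w *s foldr act w x)"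

lemma alg_act_single: "alg_act (Poly_Mapping.single w c) x = c *s foldr act w x"
  by (cases "c = 0") (simp_all add: alg_act_def)

lemma alg_act_plus: "alg_act (a + b) x = alg_act a x + alg_act b x"
  unfolding alg_act_def by (rule setsum_keys_plus_distrib) (simp_all add: scale_left_distrib)

lemma alg_act_zero [simp]: "alg_act 0 x = 0"
  by (simp add: alg_act_def)

lemma alg_act_uminus: "alg_act (- a) x = - alg_act a x"
  by (metis add.right_inverse alg_act_plus alg_act_zero minus_unique)

lemma alg_act_diff: "alg_act (a - b) x = alg_act a x - alg_act b x"
  using alg_act_plus[of a "- b"] by (simp add: alg_act_uminus)

lemma foldr_act_add: "foldr act w (x + y) = foldr act w x + foldr act w y"
  by (induction w) (simp_all add: act_add)

lemma foldr_act_scale: "foldr act w (c *s x) = c *s foldr act w x"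
  by (induction w) (simp_all add: act_scale)

lemma alg_act_add: "alg_act a (x + y) = alg_act a x + alg_act a y"
  by (simp add: alg_act_def foldr_act_add scale_right_distrib sum.distrib)

lemma alg_act_zero_right [simp]: "alg_act a 0 = 0"
  using alg_act_add[of a 0 0] by simp

lemma alg_act_mult: "alg_act (a * b) x = alg_act a (alg_act b x)"
proof (induction a rule: poly_mapping_additive_induct)
  case (single w c)
  show ?case
  proof (induction b rule: poly_mapping_additive_induct)
    case (single w' c')
    show ?case by (simp add: mult_single alg_act_single plus_list_def foldr_act_scale)
  qed (simp_all add: alg_act_plus alg_act_add distrib_left)
qed (simp_all add: alg_act_plus distrib_right)

lemma alg_act_one [simp]: "alg_act 1 x = x"
  using alg_act_single[of "[]" 1 x] by (simp add: zero_list_def flip: single_one)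

lemma alg_act_gen [simp]: "alg_act (gen g) x = act g x"
  by (simp add: gen_def alg_act_single)

lemma alg_act_cst [simp]: "alg_act (cst c) x = c *s x"
  by (simp add: cst_def alg_act_single)

text \<open>The annihilator is a two-sided ideal, so it contains the Hecke ideal as soon as it contains the
  defining relations.\<close>

lemma ideal_annihilator: "ideal {a. \<forall>x. alg_act a x = 0} ring_of_type_algebra"
proof (rule idealI[OF ring_of_type_algebra_ring])
  have inv: "inv\<^bsub>add_monoid FA\<^esub> a = - a" for a
    using abelian_group.minus_equality[OF ring.is_abelian_group[OF ring_of_type_algebra_ring], of "- a" a]
    by (simp add: FA_simps a_inv_def)
  show "subgroup {a. \<forall>x. alg_act a x = 0} (add_monoid FA)"
  proof (rule subgroup.intro)
    show "inv\<^bsub>add_monoid FA\<^esub> a \<in> {a. \<forall>x. alg_act a x = 0}"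
      if "a \<in> {a. \<forall>x. alg_act a x = 0}" for a
      using that unfolding inv by (simp add: alg_act_uminus)
  qed (simp_all add: FA_simps alg_act_plus)
qed (simp_all add: FA_simps alg_act_mult)

lemma alg_act_hecke_ideal:
  assumes "\<And>a x. a \<in> hecke_relations q \<Longrightarrow> alg_act a x = 0" and "a \<in> hecke_ideal q"
  shows "alg_act a x = 0"
  using ring.genideal_minimal[OF ring_of_type_algebra_ring ideal_annihilator, of "hecke_relations q"]
    assms by (auto simp: hecke_ideal_def)

text \<open>The choice of a representative is immaterial once the relations act by zero.\<close>

definition hecke_act :: "complex \<Rightarrow> free_alg set \<Rightarrow> 'e \<Rightarrow> 'e" where
  "hecke_act q A = alg_act (SOME a. cls q a = A)"

lemma hecke_act_cls:
  assumes "\<And>a x. a \<in> hecke_relations q \<Longrightarrow> alg_act a x = 0"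
  shows "hecke_act q (cls q a) x = alg_act a x"
proof -
  have "cls q (SOME b. cls q b = cls q a) = cls q a" by (rule someI) (rule refl)
  then have "(SOME b. cls q b = cls q a) - a \<in> hecke_ideal q" using cls_eq_iff by blast
  from alg_act_hecke_ideal[OF assms this] show ?thesis
    by (simp add: hecke_act_def alg_act_diff)
qed

end

section \<open>Divided differences in the group algebra of the weight lattice\<close>

primrec fund_weight :: "node \<Rightarrow> weight" where
  "fund_weight Node1 = (1, 0)"
| "fund_weight Node2 = (0, 1)"

text \<open>The lattice is generated by the fundamental weights as a group; negation takes the place of a zero case.\<close>

lemma weight_induct [case_names fund add neg]:
  assumes fund: "\<And>j. P (fund_weight j)"
    and add: "\<And>\<nu> \<mu>. P \<nu> \<Longrightarrow> P \<mu> \<Longrightarrow> P (\<nu> + \<mu>)" and neg: "\<And>\<nu>. P \<nu> \<Longrightarrow> P (- \<nu>)"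
  shows "P \<nu>"
proof -
  have mult: "P (scale n \<nu>)" if P: "P \<nu>" for n \<nu>
  proof (induction n rule: int_induct[where k = 0])
    case base
    show ?case using add[OF P neg[OF P]] by (simp add: scale_def zero_prod_def)
  next
    case (step1 n)
    from add[OF step1(2) P] show ?case
      by (simp add: scale_def algebra_simps plus_prod_def)
  next
    case (step2 n)
    from add[OF step2(2) neg[OF P]] show ?case
      by (simp add: scale_def algebra_simps plus_prod_def)
  qed
  show ?thesis
    using add[OF mult[OF fund[of Node1], of "fst \<nu>"] mult[OF fund[of Node2], of "snd \<nu>"]]
    by (simp add: scale_def)
qed

lemma simple_refl_add: "simple_refl i (\<nu> + \<mu>) = simple_refl i \<nu> + simple_refl i \<mu>"
  by (cases i; cases \<nu>; cases \<mu>) (simp_all add: simple_refl_def scale_def algebra_simps)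

lemma simple_refl_uminus: "simple_refl i (- \<nu>) = - simple_refl i \<nu>"
  by (cases i; cases \<nu>) (simp_all add: simple_refl_def scale_def algebra_simps)

lemma mon_mult: "mon \<nu> * mon \<mu> = mon (\<nu> + \<mu>)"
  by (simp add: mon_def mult_single)

lemma mon_zero [simp]: "mon 0 = 1"
  by (simp add: mon_def)

text \<open>Multiplication by a monomial translates the coefficients.\<close>

lemma lookup_mult_mon: "Poly_Mapping.lookup (f * mon \<beta>) (\<nu> + \<beta>) = Poly_Mapping.lookup f \<nu>"
  by (induction f rule: poly_mapping_additive_induct)
    (simp_all add: mon_def mult_single lookup_single distrib_right lookup_add when_def)

text \<open>The coefficients of \<open>f = f X\<^sup>\<beta>\<close> are invariant under translation by \<open>\<beta>\<close>, so one nonzero coefficient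
  would produce infinitely many.\<close>

lemma mult_one_minus_mon_eq_zero:
  assumes "\<beta> \<noteq> 0" and "f * (1 - mon \<beta>) = 0"
  shows "f = 0"
proof (rule ccontr)
  assume "f \<noteq> 0"
  then obtain \<nu> where \<nu>: "\<nu> \<in> Poly_Mapping.keys f"
    by (metis all_not_in_conv keys_eq_empty)
  have f: "f * mon \<beta> = f" using assms(2) by (simp add: algebra_simps)
  have "\<nu> + scale (int n) \<beta> \<in> Poly_Mapping.keys f" for n
  proof (induction n)
    case (Suc n)
    have "\<nu> + scale (int (Suc n)) \<beta> = (\<nu> + scale (int n) \<beta>) + \<beta>"
      by (cases \<nu>; cases \<beta>) (simp add: scale_def algebra_simps)
    then show ?case using Suc f lookup_mult_mon by (metis in_keys_iff)
  qed (use \<nu> in \<open>simp add: scale_def flip: zero_prod_def\<close>)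
  moreover have "inj (\<lambda>n. \<nu> + scale (int n) \<beta>)"
    using assms(1) by (auto simp: inj_def scale_def prod_eq_iff)
  ultimately have "infinite (Poly_Mapping.keys f)"
    by (intro infinite_super[OF _ range_inj_infinite]) auto
  then show False by simp
qed

text \<open>Says, without division, that \<open>f\<close> is the quotient \<open>(X\<^sup>\<nu> - X\<^bsup>s\<^sub>i\<nu>\<^esup>) / (1 - X\<^bsup>-\<alpha>\<^sub>i\<^esup>)\<close>. This quotient
  is a twisted derivation in \<open>\<nu>\<close>: it satisfies \<open>f\<^bsub>\<nu>+\<mu>\<^esub> = X\<^sup>\<nu> f\<^sub>\<mu> + f\<^sub>\<nu> X\<^bsup>s\<^sub>i\<mu>\<^esup>\<close>, which determines it from its values at
  the fundamental weights.\<close>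

definition divided_difference :: "node \<Rightarrow> weight \<Rightarrow> grp_alg \<Rightarrow> bool" where
  "divided_difference i \<nu> f \<longleftrightarrow> f * (1 - mon (- simple_root i)) = mon \<nu> - mon (simple_refl i \<nu>)"

text \<open>Here \<open>s\<^sub>i\<omega>\<^sub>i = \<omega>\<^sub>i - \<alpha>\<^sub>i\<close>, and \<open>s\<^sub>i\<close> fixes the other fundamental weight.\<close>

lemma divided_difference_fund:
  "divided_difference i (fund_weight j) (if j = i then mon (fund_weight j) else 0)"
proof -
  have "fund_weight i - simple_root i = simple_refl i (fund_weight i)"
    by (cases i) (simp_all add: simple_refl_def scale_def)
  moreover have "simple_refl i (fund_weight j) = fund_weight j" if "j \<noteq> i"
    using that by (cases i; cases j) (simp_all add: simple_refl_def scale_def)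
  ultimately show ?thesis
    by (simp add: divided_difference_def right_diff_distrib mon_mult)
qed

lemma divided_difference_add:
  assumes "divided_difference i \<nu> f" "divided_difference i \<mu> g"
  shows "divided_difference i (\<nu> + \<mu>) (mon \<nu> * g + f * mon (simple_refl i \<mu>))"
proof -
  have "(mon \<nu> * g + f * mon (simple_refl i \<mu>)) * (1 - mon (- simple_root i))
      = mon \<nu> * (g * (1 - mon (- simple_root i))) + (f * (1 - mon (- simple_root i))) * mon (simple_refl i \<mu>)"
    by (simp add: algebra_simps)
  also have "\<dots> = mon (\<nu> + \<mu>) - mon (simple_refl i (\<nu> + \<mu>))"
    unfolding assms[unfolded divided_difference_def]
    by (simp add: left_diff_distrib right_diff_distrib mon_mult simple_refl_add)
  finally show ?thesis unfolding divided_difference_def .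
qed

lemma divided_difference_neg:
  assumes "divided_difference i \<nu> f"
  shows "divided_difference i (- \<nu>) (- (mon (- \<nu>) * f * mon (simple_refl i (- \<nu>))))"
proof -
  have "- (mon (- \<nu>) * f * mon (simple_refl i (- \<nu>))) * (1 - mon (- simple_root i))
      = - (mon (- \<nu>) * (f * (1 - mon (- simple_root i))) * mon (simple_refl i (- \<nu>)))"
    by (simp add: algebra_simps)
  also have "\<dots> = mon (- \<nu>) - mon (simple_refl i (- \<nu>))"
    unfolding assms[unfolded divided_difference_def]
    by (simp add: left_diff_distrib right_diff_distrib mon_mult simple_refl_uminus)
  finally show ?thesis unfolding divided_difference_def .
qed

lemma divided_difference_exists: "\<exists>f. divided_difference i \<nu> f"
  by (induction \<nu> rule: weight_induct)
    (blast intro: divided_difference_fund divided_difference_add divided_difference_neg)+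

lemma divided_difference_unique:
  assumes "divided_difference i \<nu> f" "divided_difference i \<nu> g"
  shows "f = g"
proof -
  have "(f - g) * (1 - mon (- simple_root i)) = 0"
    using assms by (simp only: divided_difference_def left_diff_distrib diff_self)
  moreover have "- simple_root i \<noteq> 0"
    by (cases i) (simp_all add: zero_prod_def)
  ultimately have "f - g = 0"
    by (rule mult_one_minus_mon_eq_zero[rotated])
  then show ?thesis by simp
qed

lemma bernstein_relation_hecke:
  assumes "divided_difference i \<nu> f"
  shows "cls q (gX \<nu> * gT i) = cls q (gT i * gX (simple_refl i \<nu>) + cst (q - inverse q) * emb f)"
  by (rule hecke_relation)
    (use assms in \<open>unfold hecke_relations_def divided_difference_def, blast\<close>)

lemma emb_eq_sum_single: "emb f = (\<Sum>\<nu>\<in>Poly_Mapping.keys f. Poly_Mapping.single [GenX \<nu>] (Poly_Mapping.lookup f \<nu>))"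
  by (simp add: emb_def cst_def gen_def mult_single plus_list_def)

lemma emb_add: "emb (f + g) = emb f + emb g"
  unfolding emb_eq_sum_single by (rule setsum_keys_plus_distrib) (simp_all add: single_add)

lemma emb_single: "emb (Poly_Mapping.single \<nu> c) = Poly_Mapping.single [GenX \<nu>] c"
  by (cases "c = 0") (simp_all add: emb_eq_sum_single)

lemma emb_mon: "emb (mon \<nu>) = gX \<nu>"
  by (simp add: mon_def emb_single gen_def)

lemma emb_zero: "emb 0 = 0"
  by (simp add: emb_def)

lemma emb_uminus: "emb (- f) = - emb f"
  by (metis add.right_inverse emb_add emb_zero minus_unique)

context generator_action
begin

lemma alg_act_emb_mult:
  assumes "\<And>\<nu> \<mu> x. act (GenX (\<nu> + \<mu>)) x = act (GenX \<nu>) (act (GenX \<mu>) x)"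
  shows "alg_act (emb (f * g)) x = alg_act (emb f) (alg_act (emb g) x)"
proof (induction f rule: poly_mapping_additive_induct)
  case (single \<nu> c)
  show ?case
  proof (induction g rule: poly_mapping_additive_induct)
    case (single \<mu> d)
    show ?case by (simp add: mult_single emb_single alg_act_single assms act_scale)
  qed (simp_all add: alg_act_plus alg_act_add distrib_left emb_add)
qed (simp_all add: alg_act_plus distrib_right emb_add)

text \<open>The commutation relation between \<open>X\<^sup>\<nu>\<close> and \<open>T\<^sub>i\<close> is compatible with sums and negatives of weights, because
  \<open>X\<^sup>\<nu>T\<^sub>i - T\<^sub>iX\<^bsup>s\<^sub>i\<nu>\<^esup>\<close> and the divided difference are twisted derivations of the same kind. Hence a
  representation satisfies all its instances once it satisfies those for the fundamental weights.
  Uniqueness of the divided difference covers every \<open>f\<close> occurring in the defining relations.\<close>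

lemma act_bernstein:
  assumes X0: "\<And>x. act (GenX 0) x = x"
    and X_add: "\<And>\<nu> \<mu> x. act (GenX (\<nu> + \<mu>)) x = act (GenX \<nu>) (act (GenX \<mu>) x)"
    and fund: "\<And>j x. act (GenX (fund_weight j)) (act (GenT i) x) =
      act (GenT i) (act (GenX (simple_refl i (fund_weight j))) x)
      + (if j = i then \<delta> *s act (GenX (fund_weight j)) x else 0)"
    and f: "divided_difference i \<nu> f"
  shows "act (GenX \<nu>) (act (GenT i) x) =
    act (GenT i) (act (GenX (simple_refl i \<nu>)) x) + \<delta> *s alg_act (emb f) x"
proof -
  have act_diff: "act g (x - y) = act g x - act g y" for g x y
    by (metis act_add add_diff_cancel_right' diff_add_cancel)
  have "\<exists>f. divided_difference i \<nu> f \<and> (\<forall>x. act (GenX \<nu>) (act (GenT i) x) =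
      act (GenT i) (act (GenX (simple_refl i \<nu>)) x) + \<delta> *s alg_act (emb f) x)"
    (is "?P \<nu>")
  proof (induction \<nu> rule: weight_induct)
    case (fund j)
    then show ?case
      using divided_difference_fund[of i j] assms(3)[of j]
      by (intro exI[of _ "if j = i then mon (fund_weight j) else 0"]) (auto simp: emb_mon emb_zero)
  next
    case (add \<nu> \<mu>)
    then obtain f g where
      f: "divided_difference i \<nu> f" "\<And>x. act (GenX \<nu>) (act (GenT i) x) =
        act (GenT i) (act (GenX (simple_refl i \<nu>)) x) + \<delta> *s alg_act (emb f) x"
      and g: "divided_difference i \<mu> g" "\<And>x. act (GenX \<mu>) (act (GenT i) x) =
        act (GenT i) (act (GenX (simple_refl i \<mu>)) x) + \<delta> *s alg_act (emb g) x"
      by blast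
    show ?case
      using divided_difference_add[OF f(1) g(1)]
      by (intro exI[of _ "mon \<nu> * g + f * mon (simple_refl i \<mu>)"])
        (simp add: X_add f(2) g(2) emb_add alg_act_plus alg_act_emb_mult[OF X_add] emb_mon
          simple_refl_add act_add act_scale scale_right_distrib)
  next
    case (neg \<nu>)
    then obtain f where
      f: "divided_difference i \<nu> f" "\<And>x. act (GenX \<nu>) (act (GenT i) x) =
        act (GenT i) (act (GenX (simple_refl i \<nu>)) x) + \<delta> *s alg_act (emb f) x"
      by blast
    have X_inv: "act (GenX \<nu>) (act (GenX (- \<nu>)) x) = x" "act (GenX (- \<nu>)) (act (GenX \<nu>) x) = x" for \<nu> x
      using X_add[of \<nu> "- \<nu>"] X_add[of "- \<nu>" \<nu>] X0 by simp_all
    have "act (GenX (- \<nu>)) (act (GenT i) x) = act (GenT i) (act (GenX (simple_refl i (- \<nu>))) x)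
        + \<delta> *s alg_act (emb (- (mon (- \<nu>) * f * mon (simple_refl i (- \<nu>))))) x" for x
    proof -
      let ?y = "act (GenX (simple_refl i (- \<nu>))) x"
      have "act (GenT i) x = act (GenX \<nu>) (act (GenT i) ?y) - \<delta> *s alg_act (emb f) ?y"
        by (simp add: f(2) simple_refl_uminus X_inv)
      then have "act (GenX (- \<nu>)) (act (GenT i) x)
          = act (GenT i) ?y - \<delta> *s act (GenX (- \<nu>)) (alg_act (emb f) ?y)"
        by (simp add: act_diff act_scale X_inv)
      then show ?thesis
        by (simp add: emb_uminus alg_act_uminus alg_act_emb_mult[OF X_add] emb_mon)
    qed
    with divided_difference_neg[OF f(1)] show ?case by blast
  qed
  with divided_difference_unique[OF f] show ?thesis by blast
qed

end

section \<open>The four-dimensional model and its irreducible quotient\<close>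

type_synonym vec3 = "complex \<times> complex \<times> complex"
type_synonym vec4 = "complex \<times> complex \<times> complex \<times> complex"

fun scale3 :: "complex \<Rightarrow> vec3 \<Rightarrow> vec3" where
  "scale3 c (x, y, z) = (c * x, c * y, c * z)"

fun scale4 :: "complex \<Rightarrow> vec4 \<Rightarrow> vec4" where
  "scale4 c (x, y, z, w) = (c * x, c * y, c * z, c * w)"

fun drop_last :: "vec4 \<Rightarrow> vec3" where
  "drop_last (x, y, z, w) = (x, y, z)"

text \<open>The table of operators in the basis \<open>v, v', u, w\<close>, with the images collected by coordinates.\<close>

fun rep4 :: "complex \<Rightarrow> (weight \<Rightarrow> complex) \<Rightarrow> generator \<Rightarrow> vec4 \<Rightarrow> vec4" where
  "rep4 q t (GenT Node1) (x, y, z, w) = (y, x + (q - inverse q) * y, q * z, z - inverse q * w)"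
| "rep4 q t (GenT Node2) (x, y, z, w) =
     (q * x + 2 * y - 2 * (q + inverse q) * z, q * y, y - inverse q * z, q * w)"
| "rep4 q t (GenX \<nu>) (x, y, z, w) =
     (t \<nu> * (x + (q - inverse q) * of_int (fst \<nu>) * y), t \<nu> * y,
      t (simple_refl Node2 \<nu>) * z, t (simple_refl Node2 (simple_refl Node1 \<nu>)) * w)"

text \<open>The quotient by the line of \<open>w\<close>. The last coordinate never influences the first three, so padding
  with zero computes the induced operators.\<close>

fun rep3 :: "complex \<Rightarrow> (weight \<Rightarrow> complex) \<Rightarrow> generator \<Rightarrow> vec3 \<Rightarrow> vec3" where
  "rep3 q t g (x, y, z) = drop_last (rep4 q t g (x, y, z, 0))"

locale special_weight =
  fixes q :: complex and t :: "weight \<Rightarrow> complex"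
  assumes q_nonzero: "q \<noteq> 0" and q2_neq_1: "q\<^sup>2 \<noteq> 1" and q2_neq_m1: "q\<^sup>2 \<noteq> -1"
    and t_char: "t \<in> characters" and t_Q: "restricts_to t 1 (q\<^sup>2)"
begin

lemma t_nonzero [simp]: "t \<nu> \<noteq> 0" and t_add: "t (\<nu> + \<mu>) = t \<nu> * t \<mu>"
  using t_char unfolding characters_def by blast+

lemma t_zero [simp]: "t 0 = 1"
  using t_add[of 0 0] by simp

lemma t_uminus: "t (- \<nu>) = inverse (t \<nu>)"
  using t_add[of \<nu> "- \<nu>"] by (simp add: inverse_unique)

lemma t_simple_root:
  "t (2, -1) = 1" "t (-2, 2) = q\<^sup>2" "t (0, 1) = q\<^sup>2"
  using t_Q[unfolded restricts_to_def, rule_format, of 1 0] t_Q[unfolded restricts_to_def, rule_format, of 0 1]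
    t_Q[unfolded restricts_to_def, rule_format, of 1 1] q_nonzero
  by (simp_all add: scale_def)

text \<open>These are the remaining values of \<open>t\<close> that occur when the relations are checked at the fundamental
  weights. The value \<open>t (1, 0)\<close> itself is a square root of \<open>q\<^sup>2\<close> whose sign is left open.\<close>

lemma t_values: "t (-1, 1) = t (1, 0)" "t (1, -1) = t (1, 0) * (inverse q)\<^sup>2" "t (0, -1) = (inverse q)\<^sup>2"
  using t_add[of "(-1, 1)" "(2, -1)"] t_add[of "(1, 0)" "- (0, 1)"]
    t_uminus[of "(0, 1)"]
  by (simp_all add: t_simple_root power_inverse)

lemma q_inverse: "q * inverse q = 1"
  using q_nonzero by simp

sublocale rep4: generator_action scale4 "rep4 q t"
proof
  fix a b :: complex and x y :: vec4 and g
  obtain x1 x2 x3 x4 y1 y2 y3 y4 where [simp]: "x = (x1, x2, x3, x4)" "y = (y1, y2, y3, y4)"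
    by (metis prod_cases4)
  show "scale4 a (x + y) = scale4 a x + scale4 a y" "scale4 (a + b) x = scale4 a x + scale4 b x"
    "scale4 a (scale4 b x) = scale4 (a * b) x" "scale4 1 x = x"
    by (simp_all add: algebra_simps)
  show "rep4 q t g (x + y) = rep4 q t g x + rep4 q t g y"
    "rep4 q t g (scale4 a x) = scale4 a (rep4 q t g x)"
    by (cases "(q, t, g, x)" rule: rep4.cases; simp add: algebra_simps)+
qed

lemma drop_last_add: "drop_last (x + y) = drop_last x + drop_last y"
  by (cases x; cases y) simp

lemma drop_last_scale: "drop_last (scale4 c x) = scale3 c (drop_last x)"
  by (cases x) simp

lemma drop_last_rep4: "drop_last (rep4 q t g x) = rep3 q t g (drop_last x)"
  by (cases "(q, t, g, x)" rule: rep4.cases) simp_all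

lemma drop_last_surj: "\<exists>y. x = drop_last y"
  by (metis drop_last.simps prod_cases3)

sublocale rep3: generator_action scale3 "rep3 q t"
proof
  fix a b :: complex and x y :: vec3 and g
  obtain x' y' where xy: "x = drop_last x'" "y = drop_last y'" using drop_last_surj by blast
  show "scale3 a (x + y) = scale3 a x + scale3 a y" "scale3 (a + b) x = scale3 a x + scale3 b x"
    "scale3 a (scale3 b x) = scale3 (a * b) x" "scale3 1 x = x"
    "rep3 q t g (x + y) = rep3 q t g x + rep3 q t g y"
    "rep3 q t g (scale3 a x) = scale3 a (rep3 q t g x)"
    unfolding xy
    by (simp_all only: rep4.scale_right_distrib rep4.scale_left_distrib rep4.scale_scale rep4.scale_one
        rep4.act_add rep4.act_scale flip: drop_last_add drop_last_scale drop_last_rep4)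
qed

lemma drop_last_alg_act: "drop_last (rep4.alg_act a x) = rep3.alg_act a (drop_last x)"
proof (induction a rule: poly_mapping_additive_induct)
  case (single w c)
  have "drop_last (foldr (rep4 q t) w x) = foldr (rep3 q t) w (drop_last x)"
    by (induction w) (simp_all add: drop_last_rep4)
  then show ?case
    by (simp add: rep4.alg_act_single rep3.alg_act_single drop_last_scale)
qed (simp add: rep4.alg_act_plus rep3.alg_act_plus drop_last_add)

lemma rep4_X_zero: "rep4 q t (GenX 0) x = x"
proof -
  have "simple_refl i 0 = 0" for i by (cases i) (simp_all add: simple_refl_def scale_def zero_prod_def)
  then show ?thesis by (cases x) simp
qed

lemma rep4_X_add: "rep4 q t (GenX (\<nu> + \<mu>)) x = rep4 q t (GenX \<nu>) (rep4 q t (GenX \<mu>) x)"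
  by (cases x) (simp add: t_add simple_refl_add algebra_simps)

lemma rep4_bernstein_fundamental:
  "rep4 q t (GenX (fund_weight j)) (rep4 q t (GenT i) x) =
      rep4 q t (GenT i) (rep4 q t (GenX (simple_refl i (fund_weight j))) x)
      + (if j = i then scale4 (q - inverse q) (rep4 q t (GenX (fund_weight j)) x) else 0)"
proof -
  obtain a b c d where x: "x = (a, b, c, d)" by (metis prod_cases4)
  define p s where "p = inverse q" and "s = t (1, 0)"
  have pq: "q * p = 1" "p * q = 1" "q * (p * y) = y" "p * (q * y) = y" for y
    using q_nonzero by (simp_all add: p_def)
  show ?thesis
    by (cases i; cases j;
        simp add: x simple_refl_def scale_def t_simple_root t_values flip: p_def s_def;
        simp add: algebra_simps power2_eq_square pq)
qed

lemma rep4_relations: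
  assumes "a \<in> hecke_relations q"
  shows "rep4.alg_act a x = 0"
proof -
  obtain x1 x2 x3 x4 where [simp]: "x = (x1, x2, x3, x4)" by (metis prod_cases4)
  define p where "p = inverse q"
  have pq: "q * p = 1" "p * q = 1" "q * (p * y) = y" "p * (q * y) = y" for y
    using q_nonzero by (simp_all add: p_def)
  consider (one) "a = gX 0 - 1" | (add) \<nu> \<mu> where "a = gX \<nu> * gX \<mu> - gX (\<nu> + \<mu>)"
    | (quadratic) i where "a = gT i * gT i - (cst (q - inverse q) * gT i + 1)"
    | (braid) "a = gT Node1 * gT Node2 * gT Node1 * gT Node2 - gT Node2 * gT Node1 * gT Node2 * gT Node1"
    | (bernstein) i \<nu> f where
        "a = gX \<nu> * gT i - (gT i * gX (simple_refl i \<nu>) + cst (q - inverse q) * emb f)"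
        "divided_difference i \<nu> f"
    using assms unfolding hecke_relations_def divided_difference_def by auto
  then show ?thesis
  proof cases
    case one
    then show ?thesis by (simp only: rep4.alg_act_diff rep4.alg_act_gen rep4_X_zero rep4.alg_act_one diff_self)
  next
    case add
    then show ?thesis by (simp only: rep4.alg_act_diff rep4.alg_act_gen rep4.alg_act_mult rep4_X_add diff_self)
  next
    case quadratic
    show ?thesis unfolding quadratic
      by (cases i) (simp_all add: rep4.alg_act_diff rep4.alg_act_plus rep4.alg_act_mult zero_prod_def
          algebra_simps pq flip: p_def)
  next
    case braid
    show ?thesis unfolding braid
      by (simp add: rep4.alg_act_diff rep4.alg_act_plus rep4.alg_act_mult zero_prod_def
          algebra_simps pq flip: p_def)
  next
    case bernstein
    have "rep4 q t (GenX \<nu>) (rep4 q t (GenT i) x) =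
        rep4 q t (GenT i) (rep4 q t (GenX (simple_refl i \<nu>)) x) + scale4 (q - inverse q) (rep4.alg_act (emb f) x)"
      by (rule rep4.act_bernstein[OF rep4_X_zero rep4_X_add rep4_bernstein_fundamental bernstein(2)])
    then show ?thesis unfolding bernstein(1) by (simp only: rep4.alg_act_diff rep4.alg_act_gen rep4.alg_act_mult
          rep4.alg_act_plus rep4.alg_act_cst diff_self)
  qed
qed

lemma rep3_relations:
  assumes "a \<in> hecke_relations q"
  shows "rep3.alg_act a x = 0"
proof -
  obtain y where "x = drop_last y" using drop_last_surj by blast
  then have "rep3.alg_act a x = drop_last 0"
    using rep4_relations[OF assms] by (simp only: flip: drop_last_alg_act)
  then show ?thesis by (simp add: zero_prod_def)
qed

lemma rep4_act_cls: "rep4.hecke_act q (cls q a) x = rep4.alg_act a x"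
  by (rule rep4.hecke_act_cls) (rule rep4_relations)

lemma rep3_act_cls: "rep3.hecke_act q (cls q a) x = rep3.alg_act a x"
  by (rule rep3.hecke_act_cls) (rule rep3_relations)

text \<open>The operator \<open>X\<^bsup>\<alpha>\<^sub>1\<^esup> - 1\<close> maps \<open>(a, b, c)\<close> to \<open>(2\<delta>b, 0, (q\<^sup>2 - 1)c)\<close>. Its square isolates the third
  coordinate; if that coordinate vanishes, one application moves the second to the first. In every
  case the first basis vector is reached, and it generates the space.\<close>

lemma rep3_irreducible:
  assumes stable: "\<And>g x. x \<in> D \<Longrightarrow> rep3 q t g x \<in> D"
    and add: "\<And>x y. x \<in> D \<Longrightarrow> y \<in> D \<Longrightarrow> x + y \<in> D"
    and scale: "\<And>c x. x \<in> D \<Longrightarrow> scale3 c x \<in> D"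
    and nonzero: "x \<in> D" "x \<noteq> 0"
  shows "D = UNIV"
proof -
  define d where "d = q - inverse q"
  have "q * d = q\<^sup>2 - 1" "q * (q + inverse q) = q\<^sup>2 + 1"
    by (simp_all add: d_def right_diff_distrib distrib_left q_inverse power2_eq_square)
  then have d: "d \<noteq> 0" and e: "q + inverse q \<noteq> 0"
    using q2_neq_1 q2_neq_m1 by (auto simp: eq_neg_iff_add_eq_0)
  have diff: "a - b \<in> D" if "a \<in> D" "b \<in> D" for a b
    using add[OF that(1) scale[OF that(2), of "-1"]] by (cases a; cases b) simp
  obtain a b c where x: "x = (a, b, c)" by (metis prod_cases3)
  let ?Y = "\<lambda>x. rep3 q t (GenX (2, -1)) x - x"
  have Y: "?Y (a, b, c) = (2 * d * b, 0, (q\<^sup>2 - 1) * c)" for a b c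
    by (simp add: t_simple_root simple_refl_def scale_def d_def algebra_simps)
  have YD: "?Y y \<in> D" if "y \<in> D" for y by (intro diff stable that)
  have e1: "(1, 0, 0) \<in> D"
  proof (cases "c = 0")
    case False
    have "?Y (?Y x) = (0, 0, (q\<^sup>2 - 1)\<^sup>2 * c)"
      unfolding x Y by (simp add: power2_eq_square)
    then have "(0, 0, (q\<^sup>2 - 1)\<^sup>2 * c) \<in> D" using YD[OF YD[OF nonzero(1)]] by simp
    from scale[OF this, of "inverse ((q\<^sup>2 - 1)\<^sup>2 * c)"] have e3: "(0, 0, 1) \<in> D"
      using False q2_neq_1
      by (simp add: left_inverse del: inverse_mult_distrib)
    \<comment> \<open>This is the place where the hypothesis that the square of q differs from -1 enters.\<close>
    from add[OF stable[OF e3, of "GenT Node2"] scale[OF e3, of "inverse q"]]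
    have "(- 2 * (q + inverse q), 0, 0) \<in> D" by simp
    from scale[OF this, of "inverse (- 2 * (q + inverse q))"] show ?thesis
      unfolding scale3.simps by (subst (asm) left_inverse) (use e in \<open>auto simp: add_eq_0_iff\<close>)
  next
    case c: True
    show ?thesis
    proof (cases "b = 0")
      case False
      have "(2 * d * b, 0, 0) \<in> D" using YD[OF nonzero(1)] unfolding x c Y by simp
      from scale[OF this, of "inverse (2 * d * b)"] show ?thesis
        unfolding scale3.simps by (subst (asm) left_inverse) (use d False in simp_all)
    next
      case True
      then have "a \<noteq> 0" using nonzero x c by (simp add: zero_prod_def)
      then show ?thesis using scale[OF nonzero(1), of "inverse a"] x c True by simp
    qed
  qed
  from stable[OF e1, of "GenT Node1"] have e2: "(0, 1, 0) \<in> D" by simp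
  from diff[OF diff[OF stable[OF e2, of "GenT Node2"] scale[OF e2, of q]] scale[OF e1, of 2]]
  have e3: "(0, 0, 1) \<in> D" by simp
  have "(a, b, c) \<in> D" for a b c
    using add[OF scale[OF e1, of a] add[OF scale[OF e2, of b] scale[OF e3, of c]]] by simp
  then show ?thesis by auto
qed

end

section \<open>Quotients of modules by kernels\<close>

lemma (in left_module) smult_r_null [simp]:
  assumes "a \<in> carrier R" shows "a \<odot>\<^bsub>M\<^esub> \<zero>\<^bsub>M\<^esub> = \<zero>\<^bsub>M\<^esub>"
proof -
  have "a \<odot>\<^bsub>M\<^esub> \<zero>\<^bsub>M\<^esub> \<oplus>\<^bsub>M\<^esub> a \<odot>\<^bsub>M\<^esub> \<zero>\<^bsub>M\<^esub> = a \<odot>\<^bsub>M\<^esub> \<zero>\<^bsub>M\<^esub>"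
    using smult_r_distr[OF assms M.zero_closed M.zero_closed] by simp
  then show ?thesis using assms by (simp add: M.add.l_cancel_one)
qed

lemma left_module_kernel_submodule:
  fixes \<phi> :: "'b \<Rightarrow> 'e::ab_group_add"
  assumes "left_module R M"
    and add: "\<And>x y. x \<in> carrier M \<Longrightarrow> y \<in> carrier M \<Longrightarrow> \<phi> (x \<oplus>\<^bsub>M\<^esub> y) = \<phi> x + \<phi> y"
    and smult: "\<And>r x. r \<in> carrier R \<Longrightarrow> x \<in> carrier M \<Longrightarrow> \<phi> (r \<odot>\<^bsub>M\<^esub> x) = \<rho> r (\<phi> x)"
    and rho_zero: "\<And>r. r \<in> carrier R \<Longrightarrow> \<rho> r 0 = 0"
  shows "submodule {x \<in> carrier M. \<phi> x = 0} R M"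
proof -
  interpret left_module R M by fact
  have zero: "\<phi> \<zero>\<^bsub>M\<^esub> = 0" using add[of "\<zero>\<^bsub>M\<^esub>" "\<zero>\<^bsub>M\<^esub>"] by simp
  have neg: "\<phi> (\<ominus>\<^bsub>M\<^esub> x) = - \<phi> x" if "x \<in> carrier M" for x
    using add[of "\<ominus>\<^bsub>M\<^esub> x" x] that zero by (simp add: M.l_neg eq_neg_iff_add_eq_0)
  show ?thesis
  proof (intro submodule.intro subgroup.intro submodule_axioms.intro)
    fix x assume "x \<in> {x \<in> carrier M. \<phi> x = 0}"
    then show "inv\<^bsub>add_monoid M\<^esub> x \<in> {x \<in> carrier M. \<phi> x = 0}"
      using neg by (simp flip: a_inv_def)
  qed (auto simp: zero add smult rho_zero)
qed

text \<open>A homomorphism \<open>\<phi>\<close> to a simple module induces a bijection from the quotient by its kernel: a submodule of the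
  quotient is determined by the image under \<open>\<phi>\<close> of the union of its cosets. The target is a type
  with an action \<open>\<rho>\<close>, so that concrete coordinate spaces can be used directly.\<close>

lemma irreducible_quotient_by_kernel:
  fixes \<phi> :: "'b \<Rightarrow> 'e::ab_group_add"
  assumes M: "left_module R M"
    and add: "\<And>x y. x \<in> carrier M \<Longrightarrow> y \<in> carrier M \<Longrightarrow> \<phi> (x \<oplus>\<^bsub>M\<^esub> y) = \<phi> x + \<phi> y"
    and smult: "\<And>r x. r \<in> carrier R \<Longrightarrow> x \<in> carrier M \<Longrightarrow> \<phi> (r \<odot>\<^bsub>M\<^esub> x) = \<rho> r (\<phi> x)"
    and rho_zero: "\<And>r. r \<in> carrier R \<Longrightarrow> \<rho> r 0 = 0"
    and nontrivial: "m \<in> carrier M" "\<phi> m \<noteq> 0"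
    and irred: "\<And>D x. \<lbrakk>\<And>x y. x \<in> D \<Longrightarrow> y \<in> D \<Longrightarrow> x + y \<in> D;
        \<And>r x. r \<in> carrier R \<Longrightarrow> x \<in> D \<Longrightarrow> \<rho> r x \<in> D; x \<in> D; x \<noteq> 0\<rbrakk> \<Longrightarrow> D = UNIV"
  shows "irreducible_module R (quot_module M {x \<in> carrier M. \<phi> x = 0})"
proof -
  define K where "K = {x \<in> carrier M. \<phi> x = 0}"
  define Q where "Q = quot_module M K"
  interpret left_module R M by fact
  have K: "submodule K R M"
    unfolding K_def using M add smult rho_zero by (rule left_module_kernel_submodule)
  interpret K: abelian_subgroup K M
    by (rule abelian_subgroupI3)
      (auto intro: additive_subgroup.intro submodule.axioms(1)[OF K] M.abelian_group_axioms)
  have QM: "left_module R Q" unfolding Q_def using M K by (rule left_module_quot_module)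
  interpret Q: left_module R Q by fact
  have car: "carrier Q = a_rcosets\<^bsub>M\<^esub> K" and zero: "\<zero>\<^bsub>Q\<^esub> = K"
    by (simp_all add: Q_def quot_module_def)
  have coset: "A = K +>\<^bsub>M\<^esub> x" "x \<in> carrier M" if A: "A \<in> carrier Q" "x \<in> A" for A x
  proof -
    obtain y where y: "y \<in> carrier M" "A = K +>\<^bsub>M\<^esub> y"
      using A(1) by (auto simp: car A_RCOSETS_def RCOSETS_def a_r_coset_def)
    then show "A = K +>\<^bsub>M\<^esub> x" using A(2) K.a_repr_independence' by blast
    show "x \<in> carrier M" using A(2) y K.a_elemrcos_carrier by blast
  qed
  have rep: "\<exists>x. x \<in> A" if "A \<in> carrier Q" for A
  proof -
    obtain y where "y \<in> carrier M" "A = K +>\<^bsub>M\<^esub> y"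
      using \<open>A \<in> carrier Q\<close> by (auto simp: car A_RCOSETS_def RCOSETS_def a_r_coset_def)
    then show ?thesis using K.a_rcos_self by blast
  qed
  have in_Q: "K +>\<^bsub>M\<^esub> x \<in> carrier Q" if "x \<in> carrier M" for x
    unfolding car using that K.a_subset M.a_rcosetsI by blast
  have same: "K +>\<^bsub>M\<^esub> x = K +>\<^bsub>M\<^esub> y" if "x \<in> carrier M" "y \<in> carrier M" "\<phi> x = \<phi> y" for x y
  proof -
    have "(x \<ominus>\<^bsub>M\<^esub> y) \<oplus>\<^bsub>M\<^esub> y = x"
      unfolding a_minus_def using that by (subst M.a_assoc) (simp_all add: M.l_neg)
    then have "\<phi> (x \<ominus>\<^bsub>M\<^esub> y) + \<phi> y = \<phi> x"
      using add[of "x \<ominus>\<^bsub>M\<^esub> y" y] that(1,2) by (simp only: M.minus_closed)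
    then have "\<phi> (x \<ominus>\<^bsub>M\<^esub> y) = 0" using that(3) by (metis add_cancel_left_left)
    then have "x \<ominus>\<^bsub>M\<^esub> y \<in> K" unfolding K_def using M.minus_closed[OF that(1,2)] by blast
    then have "x \<in> K +>\<^bsub>M\<^esub> y"
      using K.a_rcos_module[OF that(2,1)] by (simp only: a_minus_def)
    then show ?thesis using K.a_repr_independence' that by blast
  qed
  have "N = {K} \<or> N = carrier Q" if N: "submodule N R Q" for N
  proof (rule disjCI)
    assume "N \<noteq> carrier Q"
    interpret N: submodule N R Q by fact
    have NQ: "A \<in> carrier Q" if "A \<in> N" for A using N.subset that by auto
    show "N = {K}"
    proof (rule ccontr)
      assume "N \<noteq> {K}"
      moreover have "K \<in> N" using N.one_closed zero by simp
      ultimately obtain A where A: "A \<in> N" "A \<noteq> K" by blast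
      then obtain x where x: "x \<in> A" using rep NQ by blast
      have "\<phi> x \<noteq> 0"
      proof
        assume "\<phi> x = 0"
        then have "x \<in> K" using coset(2)[OF NQ[OF A(1)] x] unfolding K_def by blast
        then have "A = K" using coset(1)[OF NQ[OF A(1)] x] K.a_rcos_const by metis
        with A show False by blast
      qed
      have "\<phi> ` \<Union>N = UNIV"
      proof (rule irred)
        fix x y assume "x \<in> \<phi> ` \<Union>N" "y \<in> \<phi> ` \<Union>N"
        then obtain A B c d where *: "A \<in> N" "B \<in> N" "c \<in> A" "d \<in> B" "x = \<phi> c" "y = \<phi> d"
          by blast
        then have "c \<oplus>\<^bsub>M\<^esub> d \<in> A \<oplus>\<^bsub>Q\<^esub> B"
          by (auto simp: Q_def quot_module_def set_add_def set_mult_def)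
        moreover have "A \<oplus>\<^bsub>Q\<^esub> B \<in> N" using N.m_closed * by simp
        ultimately show "x + y \<in> \<phi> ` \<Union>N"
          using add[OF coset(2)[OF NQ[OF *(1)] *(3)] coset(2)[OF NQ[OF *(2)] *(4)]] *(5,6) by force
      next
        fix r x assume r: "r \<in> carrier R" and "x \<in> \<phi> ` \<Union>N"
        then obtain A c where *: "A \<in> N" "c \<in> A" "x = \<phi> c" by blast
        have c: "c \<in> carrier M" using * coset(2) NQ by blast
        have "r \<odot>\<^bsub>M\<^esub> c \<in> r \<odot>\<^bsub>Q\<^esub> A"
          using * c r K.a_rcos_self[of "r \<odot>\<^bsub>M\<^esub> c"] by (auto simp: Q_def quot_module_def)
        moreover have "r \<odot>\<^bsub>Q\<^esub> A \<in> N" using N.smult_closed * r by simp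
        ultimately show "\<rho> r x \<in> \<phi> ` \<Union>N"
          using smult[OF r c] *(3) by force
      qed (use A x \<open>\<phi> x \<noteq> 0\<close> in auto)
      have "B \<in> N" if B: "B \<in> carrier Q" for B
      proof -
        obtain y where y: "y \<in> carrier M" "B = K +>\<^bsub>M\<^esub> y"
          using B by (auto simp: car A_RCOSETS_def RCOSETS_def a_r_coset_def)
        obtain C c where c: "C \<in> N" "c \<in> C" "\<phi> y = \<phi> c"
          using \<open>\<phi> ` \<Union>N = UNIV\<close> UNIV_I[of "\<phi> y"] by (metis (no_types) UnionE imageE)
        note C = coset[OF NQ[OF c(1)] c(2)]
        have "B = C" using same[OF y(1) C(2) c(3)] y(2) C(1) by simp
        with c show ?thesis by simp
      qed
      with NQ have "N = carrier Q" by blast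
      with \<open>N \<noteq> carrier Q\<close> show False by simp
    qed
  qed
  moreover have "carrier Q \<noteq> {K}"
  proof
    assume "carrier Q = {K}"
    then have "m \<in> K" using in_Q[OF nontrivial(1)] K.a_rcos_self[OF nontrivial(1)] by blast
    then show False using nontrivial(2) unfolding K_def by blast
  qed
  ultimately show ?thesis
    using QM unfolding irreducible_module_def zero K_def[symmetric] Q_def[symmetric] by auto
qed

section \<open>The universal property of induced modules\<close>

text \<open>The tensor product \<open>R \<otimes>\<^sub>S V\<close> is a quotient of a free abelian group by the subgroup of relations. All
  computations with cosets are confined to this locale; from outside it is used through pure tensors, the
  induction principle for elements, and the universal property.\<close>

locale induction_data =
  fixes R :: "('a, 'd) ring_scheme" and S :: "('a, 'e) ring_scheme" and V :: "('a, 'b, 'c) module_scheme"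
  assumes ring_R: "ring R" and S_sub: "carrier S \<subseteq> carrier R" and V_module: "left_module S V"
begin

sublocale R: ring R by (rule ring_R)
sublocale V: left_module S V by (rule V_module)

abbreviation "Free \<equiv> free_Abelian_group (carrier R \<times> carrier V)"
definition "Rel = generate Free (tensor_relations R S V)"
abbreviation "Ind \<equiv> induced_module R S V"
definition tensor :: "'a \<Rightarrow> 'b \<Rightarrow> ('a \<times> 'b \<Rightarrow>\<^sub>0 int) set" where
  "tensor a x = Rel +>\<^bsub>free_pairs R V\<^esub> frag_of (a, x)"

sublocale Ind: left_module R Ind
  by (rule left_module_induced_module[OF ring_R S_sub V_module])

lemma Free_diff:
  "c \<in> carrier Free \<Longrightarrow> d \<in> carrier Free \<Longrightarrow> c - d \<in> carrier Free"
  using keys_diff[of c d] by auto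

lemma relations_in_Free: "tensor_relations R S V \<subseteq> carrier Free"
  unfolding tensor_relations_def using S_sub
  by (auto intro!: Free_diff simp del: carrier_free_Abelian_group_iff)

lemma Rel_subgroup: "subgroup Rel Free"
  unfolding Rel_def by (rule group.generate_is_subgroup[OF group_free_Abelian_group relations_in_Free])

lemma Rel_closed:
  "0 \<in> Rel" "a \<in> Rel \<Longrightarrow> b \<in> Rel \<Longrightarrow> a + b \<in> Rel" "a \<in> Rel \<Longrightarrow> - a \<in> Rel"
  "a \<in> Rel \<Longrightarrow> Poly_Mapping.keys a \<subseteq> carrier R \<times> carrier V"
  using subgroup.one_closed[OF Rel_subgroup] subgroup.m_closed[OF Rel_subgroup]
    subgroup.m_inv_closed[OF Rel_subgroup] subgroup.subset[OF Rel_subgroup]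
  by force+

lemma mem_coset_iff: "d \<in> Rel +>\<^bsub>free_pairs R V\<^esub> c \<longleftrightarrow> d - c \<in> Rel"
  unfolding a_r_coset_def r_coset_def free_pairs_def
  by (auto simp: algebra_simps intro: bexI[of _ "d - c"])

text \<open>Elements of the tensor product are handled through arbitrary members of the cosets: an element is
  recovered from any one of its members, and sums and multiples of members lie in sums and multiples.\<close>

lemma Ind_eq_coset:
  assumes "A \<in> carrier Ind" "c \<in> A"
  shows "A = Rel +>\<^bsub>free_pairs R V\<^esub> c" "c \<in> carrier Free"
proof -
  obtain d where d: "d \<in> carrier Free" "A = Rel +>\<^bsub>free_pairs R V\<^esub> d"
    using assms(1) unfolding induced_module_def quot_module_def Rel_def[symmetric]
    by (auto simp: A_RCOSETS_def RCOSETS_def a_r_coset_def free_pairs_def)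
  have cd: "c - d \<in> Rel" using assms(2) d mem_coset_iff by simp
  have "e - d \<in> Rel \<longleftrightarrow> e - c \<in> Rel" for e
    using Rel_closed(2)[of "e - d" "- (c - d)"] Rel_closed(2)[of "e - c" "c - d"] Rel_closed(3)[OF cd] cd
    by auto
  then show "A = Rel +>\<^bsub>free_pairs R V\<^esub> c" using d mem_coset_iff by blast
  show "c \<in> carrier Free"
    using Rel_closed(4)[OF cd] d(1) keys_add[of "c - d" d] by auto
qed

lemma coset_in_Ind: "c \<in> carrier Free \<Longrightarrow> Rel +>\<^bsub>free_pairs R V\<^esub> c \<in> carrier Ind"
  unfolding induced_module_def quot_module_def Rel_def[symmetric]
  by (auto simp: A_RCOSETS_def RCOSETS_def a_r_coset_def free_pairs_def)

lemma coset_self: "c \<in> Rel +>\<^bsub>free_pairs R V\<^esub> c"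
  by (simp add: mem_coset_iff Rel_closed)

lemma add_mem_Ind: "c \<in> A \<Longrightarrow> d \<in> B \<Longrightarrow> c + d \<in> A \<oplus>\<^bsub>Ind\<^esub> B"
  by (auto simp: induced_module_def quot_module_def set_add_def set_mult_def free_pairs_def)

lemma smult_mem_Ind:
  "c \<in> A \<Longrightarrow> frag_extend (\<lambda>(a, x). frag_of (r \<otimes>\<^bsub>R\<^esub> a, x)) c \<in> r \<odot>\<^bsub>Ind\<^esub> A"
  using coset_self by (fastforce simp: induced_module_def quot_module_def free_pairs_def Rel_def)

lemma tensor_closed: "a \<in> carrier R \<Longrightarrow> x \<in> carrier V \<Longrightarrow> tensor a x \<in> carrier Ind"
  unfolding tensor_def by (rule coset_in_Ind) simp

lemma tensor_mem: "frag_of (a, x) \<in> tensor a x"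
  unfolding tensor_def by (rule coset_self)

lemma tensor_relation:
  assumes "A \<in> carrier Ind" "c \<in> A" "d \<in> carrier Free" "c - d \<in> tensor_relations R S V"
  shows "A = Rel +>\<^bsub>free_pairs R V\<^esub> d"
proof -
  have "c - d \<in> Rel" using assms(4) unfolding Rel_def by (rule generate.incl)
  then have "c \<in> Rel +>\<^bsub>free_pairs R V\<^esub> d" by (simp add: mem_coset_iff)
  then show ?thesis using Ind_eq_coset assms coset_in_Ind by metis
qed

lemma smult_tensor:
  assumes "r \<in> carrier R" "a \<in> carrier R" "x \<in> carrier V"
  shows "r \<odot>\<^bsub>Ind\<^esub> tensor a x = tensor (r \<otimes>\<^bsub>R\<^esub> a) x"
  using Ind_eq_coset(1)[OF Ind.smult_closed smult_mem_Ind[OF tensor_mem]] assms tensor_closed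
  by (simp add: tensor_def)

lemma tensor_balanced:
  assumes "a \<in> carrier R" "s \<in> carrier S" "x \<in> carrier V"
  shows "tensor (a \<otimes>\<^bsub>R\<^esub> s) x = tensor a (s \<odot>\<^bsub>V\<^esub> x)"
proof -
  have "frag_of (a \<otimes>\<^bsub>R\<^esub> s, x) - frag_of (a, s \<odot>\<^bsub>V\<^esub> x) \<in> tensor_relations R S V"
    unfolding tensor_relations_def using assms by blast
  from tensor_relation[OF tensor_closed tensor_mem _ this] show ?thesis
    using assms S_sub by (auto simp: tensor_def)
qed

lemma tensor_add_left:
  assumes "a \<in> carrier R" "b \<in> carrier R" "x \<in> carrier V"
  shows "tensor (a \<oplus>\<^bsub>R\<^esub> b) x = tensor a x \<oplus>\<^bsub>Ind\<^esub> tensor b x"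
proof -
  have rel: "frag_of (a \<oplus>\<^bsub>R\<^esub> b, x) - (frag_of (a, x) + frag_of (b, x)) \<in> tensor_relations R S V"
    unfolding tensor_relations_def diff_diff_add[symmetric] using assms by blast
  have c: "frag_of (a, x) + frag_of (b, x) \<in> tensor a x \<oplus>\<^bsub>Ind\<^esub> tensor b x"
    by (intro add_mem_Ind tensor_mem)
  note eq = Ind_eq_coset[OF Ind.M.a_closed[OF tensor_closed tensor_closed] c]
  from tensor_relation[OF tensor_closed tensor_mem eq(2) rel] eq(1) show ?thesis
    using assms by simp
qed

text \<open>Negatives of pure tensors are covered by closure under differences.\<close>

lemma Ind_induct [consumes 1, case_names zero tensor minus]:
  assumes "A \<in> carrier Ind"
    and zero: "P \<zero>\<^bsub>Ind\<^esub>"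
    and tensor: "\<And>a x. a \<in> carrier R \<Longrightarrow> x \<in> carrier V \<Longrightarrow> P (tensor a x)"
    and minus: "\<And>A B. A \<in> carrier Ind \<Longrightarrow> B \<in> carrier Ind \<Longrightarrow> P A \<Longrightarrow> P B \<Longrightarrow> P (A \<ominus>\<^bsub>Ind\<^esub> B)"
  shows "P A"
proof -
  have coset: "P (Rel +>\<^bsub>free_pairs R V\<^esub> c)" if "Poly_Mapping.keys c \<subseteq> carrier R \<times> carrier V" for c
    using that
  proof (induction c rule: free_Abelian_group_induct[consumes 1, case_names zero diff single])
    case zero
    have "Rel +>\<^bsub>free_pairs R V\<^esub> 0 = \<zero>\<^bsub>Ind\<^esub>"
      using mem_coset_iff[of _ 0] unfolding induced_module_def quot_module_def Rel_def by auto
    with assms(2) show ?case by simp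
  next
    case (diff c d)
    let ?A = "Rel +>\<^bsub>free_pairs R V\<^esub> c" and ?B = "Rel +>\<^bsub>free_pairs R V\<^esub> d"
      and ?D = "Rel +>\<^bsub>free_pairs R V\<^esub> (c - d)"
    have car: "?A \<in> carrier Ind" "?B \<in> carrier Ind" "?D \<in> carrier Ind"
      using diff Free_diff[of c d] by (auto intro!: coset_in_Ind simp del: carrier_free_Abelian_group_iff) auto
    have "(c - d) + d \<in> ?D \<oplus>\<^bsub>Ind\<^esub> ?B" by (intro add_mem_Ind coset_self)
    from Ind_eq_coset(1)[OF Ind.M.a_closed[OF car(3,2)] this]
    have "?D \<oplus>\<^bsub>Ind\<^esub> ?B = ?A" by (simp only: diff_add_cancel)
    then have "?D = ?A \<ominus>\<^bsub>Ind\<^esub> ?B"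
      using car by (metis Ind.M.a_assoc Ind.M.a_inv_closed Ind.M.r_neg Ind.M.r_zero a_minus_def)
    with minus[OF car(1,2)] diff show ?case by simp
  next
    case (single p)
    then show ?case using assms(3) by (auto simp: tensor_def)
  qed
  obtain c where "c \<in> A"
    using assms(1) coset_self unfolding induced_module_def quot_module_def Rel_def[symmetric]
    by (auto simp: A_RCOSETS_def RCOSETS_def a_r_coset_def)
  then show ?thesis using coset Ind_eq_coset[OF assms(1)] by auto
qed

text \<open>An \<open>S\<close>-linear map \<open>\<kappa>\<close> from \<open>V\<close> to a space with an \<open>R\<close>-action extends to an \<open>R\<close>-linear map on the induced
  module. The map \<open>a \<otimes> x \<mapsto> a \<kappa>(x)\<close>, extended to the free abelian group, annihilates the tensor relations and is therefore
  constant on cosets.\<close>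

lemma induced_hom_exists:
  fixes \<rho> :: "'a \<Rightarrow> 'f \<Rightarrow> 'f::ab_group_add" and \<kappa> :: "'b \<Rightarrow> 'f"
  assumes rho_add: "\<And>a b x. a \<in> carrier R \<Longrightarrow> b \<in> carrier R \<Longrightarrow> \<rho> (a \<oplus>\<^bsub>R\<^esub> b) x = \<rho> a x + \<rho> b x"
    and rho_add_right: "\<And>a x y. a \<in> carrier R \<Longrightarrow> \<rho> a (x + y) = \<rho> a x + \<rho> a y"
    and rho_mult: "\<And>a b x. a \<in> carrier R \<Longrightarrow> b \<in> carrier R \<Longrightarrow> \<rho> (a \<otimes>\<^bsub>R\<^esub> b) x = \<rho> a (\<rho> b x)"
    and kappa_add: "\<And>x y. x \<in> carrier V \<Longrightarrow> y \<in> carrier V \<Longrightarrow> \<kappa> (x \<oplus>\<^bsub>V\<^esub> y) = \<kappa> x + \<kappa> y"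
    and kappa_smult: "\<And>s x. s \<in> carrier S \<Longrightarrow> x \<in> carrier V \<Longrightarrow> \<kappa> (s \<odot>\<^bsub>V\<^esub> x) = \<rho> s (\<kappa> x)"
  obtains \<phi> where
    "\<And>A B. A \<in> carrier Ind \<Longrightarrow> B \<in> carrier Ind \<Longrightarrow> \<phi> (A \<oplus>\<^bsub>Ind\<^esub> B) = \<phi> A + \<phi> B"
    "\<And>r A. r \<in> carrier R \<Longrightarrow> A \<in> carrier Ind \<Longrightarrow> \<phi> (r \<odot>\<^bsub>Ind\<^esub> A) = \<rho> r (\<phi> A)"
    "\<And>a x. a \<in> carrier R \<Longrightarrow> x \<in> carrier V \<Longrightarrow> \<phi> (tensor a x) = \<rho> a (\<kappa> x)"
proof -
  \<comment> \<open>The additive group of the target type, as a group with explicit carrier.\<close>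
  define E where "E = \<lparr>carrier = (UNIV :: 'f set), monoid.mult = (+), one = 0 :: 'f\<rparr>"
  have "comm_group E"
  proof (rule comm_groupI)
    fix x :: 'f
    show "\<exists>y\<in>carrier E. y \<otimes>\<^bsub>E\<^esub> x = \<one>\<^bsub>E\<^esub>" by (rule bexI[of _ "- x"]) (simp_all add: E_def)
  qed (simp_all add: E_def add_ac)
  then obtain h where h: "h \<in> hom Free E"
    and h_of: "\<And>p. p \<in> carrier R \<times> carrier V \<Longrightarrow> h (frag_of p) = (\<lambda>(a, x). \<rho> a (\<kappa> x)) p"
    using comm_group.free_Abelian_group_universal[of E "\<lambda>(a, x). \<rho> a (\<kappa> x)" "carrier R \<times> carrier V"]
    by (auto simp: E_def)
  have h_add: "h (c + d) = h c + h d" if "c \<in> carrier Free" "d \<in> carrier Free" for c d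
    using hom_mult[OF h that] by (simp add: E_def)
  have h_zero: "h 0 = 0" using h_add[of 0 0] by simp
  have h_diff: "h (c - d) = h c - h d" if "c \<in> carrier Free" "d \<in> carrier Free" for c d
    using h_add[OF Free_diff[OF that] that(2)] by simp
  have h_rel: "h c = 0" if crel: "c \<in> tensor_relations R S V" for c
  proof -
    have fo: "frag_of p \<in> carrier Free" if "p \<in> carrier R \<times> carrier V" for p using that by simp
    consider (add_l) a b v where "c = frag_of (a \<oplus>\<^bsub>R\<^esub> b, v) - frag_of (a, v) - frag_of (b, v)"
        "a \<in> carrier R" "b \<in> carrier R" "v \<in> carrier V"
      | (add_r) a v w where "c = frag_of (a, v \<oplus>\<^bsub>V\<^esub> w) - frag_of (a, v) - frag_of (a, w)"
        "a \<in> carrier R" "v \<in> carrier V" "w \<in> carrier V"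
      | (bal) a s v where "c = frag_of (a \<otimes>\<^bsub>R\<^esub> s, v) - frag_of (a, s \<odot>\<^bsub>V\<^esub> v)"
        "a \<in> carrier R" "s \<in> carrier S" "v \<in> carrier V"
      using crel unfolding tensor_relations_def by blast
    then show ?thesis
    proof cases
      case add_l
      then show ?thesis by (simp add: h_diff Free_diff h_of rho_add del: carrier_free_Abelian_group_iff)
    next
      case add_r
      then show ?thesis by (simp add: h_diff Free_diff h_of kappa_add rho_add_right del: carrier_free_Abelian_group_iff)
    next
      case bal
      then have "s \<in> carrier R" using S_sub by auto
      with bal show ?thesis by (simp add: h_diff Free_diff h_of kappa_smult rho_mult del: carrier_free_Abelian_group_iff)
    qed
  qed
  have h_Rel: "h c = 0" if "c \<in> Rel" for c
    using that unfolding Rel_def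
  proof (induction rule: generate.induct)
    case (inv c)
    then have "c \<in> carrier Free" using relations_in_Free by blast
    then show ?case using h_diff[of 0 c] h_zero h_rel[OF inv] by simp
  next
    case (eng c d)
    then have "c \<in> carrier Free" "d \<in> carrier Free"
      using Rel_closed(4) unfolding Rel_def by auto
    then show ?case using eng h_add[of c d] by simp
  qed (auto simp: h_zero h_rel)
  define \<phi> where "\<phi> A = h (SOME c. c \<in> A)" for A
  have phi: "\<phi> A = h c" if A: "A \<in> carrier Ind" "c \<in> A" for A c
  proof -
    have d: "(SOME c. c \<in> A) \<in> A" using A(2) by (rule someI)
    have "c - (SOME c. c \<in> A) \<in> Rel" using Ind_eq_coset(1)[OF A(1) d] A(2) mem_coset_iff by blast
    from h_Rel[OF this] show ?thesis
      using h_diff[OF Ind_eq_coset(2)[OF A] Ind_eq_coset(2)[OF A(1) d]] by (simp add: \<phi>_def)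
  qed
  have rep: "\<exists>c. c \<in> A" if "A \<in> carrier Ind" for A
    using that coset_self unfolding induced_module_def quot_module_def Rel_def[symmetric]
    by (auto simp: A_RCOSETS_def RCOSETS_def a_r_coset_def)
  have rho_diff: "\<rho> a (x - y) = \<rho> a x - \<rho> a y" if "a \<in> carrier R" for a x y
    using rho_add_right[OF that, of "x - y" y] by simp
  have rho_zero: "\<rho> a 0 = 0" if "a \<in> carrier R" for a
    using rho_add_right[OF that, of 0 0] by simp
  show ?thesis
  proof (rule that[of \<phi>])
    fix A B assume AB: "A \<in> carrier Ind" "B \<in> carrier Ind"
    then obtain c d where cd: "c \<in> A" "d \<in> B" using rep by blast
    show "\<phi> (A \<oplus>\<^bsub>Ind\<^esub> B) = \<phi> A + \<phi> B"
      unfolding phi[OF AB(1) cd(1)] phi[OF AB(2) cd(2)] phi[OF Ind.M.a_closed[OF AB] add_mem_Ind[OF cd]]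
      by (rule h_add[OF Ind_eq_coset(2)[OF AB(1) cd(1)] Ind_eq_coset(2)[OF AB(2) cd(2)]])
  next
    fix r A assume r: "r \<in> carrier R" and A: "A \<in> carrier Ind"
    then obtain c where c: "c \<in> A" using rep by blast
    let ?r = "frag_extend (\<lambda>(a, x). frag_of (r \<otimes>\<^bsub>R\<^esub> a, x))"
    have "?r c \<in> carrier Free \<and> h (?r c) = \<rho> r (h c)"
      if "Poly_Mapping.keys c \<subseteq> carrier R \<times> carrier V" for c
      using that
    proof (induction c rule: free_Abelian_group_induct[consumes 1, case_names zero diff single])
      case zero
      show ?case by (simp add: h_zero rho_zero r)
    next
      case (diff c d)
      then show ?case using r h_diff[of c d] h_diff[of "?r c" "?r d"] Free_diff[of "?r c" "?r d"]
        by (simp add: frag_extend_diff rho_diff)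
    next
      case (single p)
      then show ?case using r by (auto simp: h_of rho_mult)
    qed
    then show "\<phi> (r \<odot>\<^bsub>Ind\<^esub> A) = \<rho> r (\<phi> A)"
      using c A r phi smult_mem_Ind[OF c, of r] Ind_eq_coset(2)[OF A c] Ind.smult_closed by simp
  next
    fix a x assume "a \<in> carrier R" "x \<in> carrier V"
    then show "\<phi> (tensor a x) = \<rho> a (\<kappa> x)"
      using phi[OF tensor_closed tensor_mem] h_of[of "(a, x)"] by simp
  qed
qed

end

section \<open>Coordinates on the module induced from a line\<close>

lemma parabolic_operations:
  "carrier (parabolic q i) = parabolic_carrier q i"
  "add (parabolic q i) = add (hecke q)" "monoid.mult (parabolic q i) = monoid.mult (hecke q)"
  "one (parabolic q i) = one (hecke q)"
  by (simp_all add: parabolic_def)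

lemma parabolic_mem:
  "hT q i \<in> parabolic_carrier q i" "hX q \<nu> \<in> parabolic_carrier q i" "hC q c \<in> parabolic_carrier q i"
  unfolding parabolic_carrier_def by (auto intro: generate_ring.incl)

locale line_module = special_weight +
  fixes V :: "(free_alg set, 'v) module" and v :: 'v
  assumes line: "is_line_module q Node2 V v q t"
begin

sublocale induction_data "hecke q" "parabolic q Node2" V
  using line ring_hecke subringE(1)[OF subring_parabolic]
  by (intro induction_data.intro) (simp_all add: is_line_module_def parabolic_operations)

lemma v_closed: "v \<in> carrier V" and v_nonzero: "v \<noteq> \<zero>\<^bsub>V\<^esub>"
  and V_eq: "carrier V = {hC q z \<odot>\<^bsub>V\<^esub> v | z. True}"
  and T2_v: "hT q Node2 \<odot>\<^bsub>V\<^esub> v = hC q q \<odot>\<^bsub>V\<^esub> v"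
  and X_v: "hX q \<nu> \<odot>\<^bsub>V\<^esub> v = hC q (t \<nu>) \<odot>\<^bsub>V\<^esub> v"
  using line unfolding is_line_module_def by blast+

lemma parabolic_smult:
  assumes "r \<in> parabolic_carrier q Node2" "s \<in> parabolic_carrier q Node2" "x \<in> carrier V"
  shows "s \<odot>\<^bsub>V\<^esub> x \<in> carrier V"
    and "(r \<oplus>\<^bsub>hecke q\<^esub> s) \<odot>\<^bsub>V\<^esub> x = r \<odot>\<^bsub>V\<^esub> x \<oplus>\<^bsub>V\<^esub> s \<odot>\<^bsub>V\<^esub> x"
    and "(r \<otimes>\<^bsub>hecke q\<^esub> s) \<odot>\<^bsub>V\<^esub> x = r \<odot>\<^bsub>V\<^esub> (s \<odot>\<^bsub>V\<^esub> x)"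
    and "\<one>\<^bsub>hecke q\<^esub> \<odot>\<^bsub>V\<^esub> x = x"
  using assms V.smult_closed[of s x] V.smult_l_distr[of r s x] V.smult_assoc1[of r s x] V.smult_one[of x]
  by (simp_all add: parabolic_operations)

lemma scalar_add: "hC q (a + b) \<odot>\<^bsub>V\<^esub> v = hC q a \<odot>\<^bsub>V\<^esub> v \<oplus>\<^bsub>V\<^esub> hC q b \<odot>\<^bsub>V\<^esub> v"
  using parabolic_smult(2)[OF parabolic_mem(3) parabolic_mem(3) v_closed, of a b]
  by (simp add: cls_add cst_add)

lemma scalar_mult: "hC q (a * b) \<odot>\<^bsub>V\<^esub> v = hC q a \<odot>\<^bsub>V\<^esub> (hC q b \<odot>\<^bsub>V\<^esub> v)"
  using parabolic_smult(3)[OF parabolic_mem(3) parabolic_mem(3) v_closed, of a b]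
  by (simp add: cls_mult cst_mult)

lemma scalar_one: "hC q 1 \<odot>\<^bsub>V\<^esub> v = v"
  using parabolic_smult(4)[OF parabolic_mem(3) parabolic_mem(3) v_closed] by (simp add: cls_one)

text \<open>The map \<open>a \<mapsto> a (1 \<otimes> v)\<close> identifies the induced module with a quotient of the free algebra by a left
  ideal. Identities in the module thereby become congruences in a ring with typed operations.\<close>

definition orbit :: "free_alg \<Rightarrow> (free_alg set \<times> 'v \<Rightarrow>\<^sub>0 int) set" where
  "orbit a = tensor (cls q a) v"

lemma orbit_closed: "orbit a \<in> carrier Ind"
  unfolding orbit_def by (rule tensor_closed[OF cls_carrier v_closed])

lemma orbit_add: "orbit (a + b) = orbit a \<oplus>\<^bsub>Ind\<^esub> orbit b"
  unfolding orbit_def cls_add[symmetric] by (rule tensor_add_left[OF cls_carrier cls_carrier v_closed])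

lemma orbit_smult: "cls q b \<odot>\<^bsub>Ind\<^esub> orbit a = orbit (b * a)"
  unfolding orbit_def cls_mult[symmetric] by (rule smult_tensor[OF cls_carrier cls_carrier v_closed])

lemma orbit_mult_left: "orbit a = orbit b \<Longrightarrow> orbit (c * a) = orbit (c * b)"
  by (metis orbit_smult)

lemma orbit_mult_cls: "cls q a = cls q b \<Longrightarrow> orbit (a * c) = orbit (b * c)"
  unfolding orbit_def by (simp flip: cls_mult)

lemma tensor_parabolic:
  assumes "cls q b \<in> parabolic_carrier q Node2"
  shows "tensor (cls q a) (cls q b \<odot>\<^bsub>V\<^esub> v) = orbit (a * b)"
  unfolding orbit_def cls_mult[symmetric]
  by (rule tensor_balanced[symmetric, OF cls_carrier _ v_closed]) (simp add: parabolic_operations assms)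

text \<open>The balancing relation lets the rightmost factor act on \<open>v\<close>, by a scalar that is then moved to the left.\<close>

lemma orbit_T2: "orbit (a * gT Node2) = orbit (cst q * a)"
  using tensor_parabolic[OF parabolic_mem(1), of a] tensor_parabolic[OF parabolic_mem(3), of a q]
  by (simp add: T2_v cst_commute)

lemma orbit_X: "orbit (a * gX \<nu>) = orbit (cst (t \<nu>) * a)"
  using tensor_parabolic[OF parabolic_mem(2), of a \<nu>] tensor_parabolic[OF parabolic_mem(3), of a "t \<nu>"]
  by (simp add: X_v cst_commute)

lemma orbit_zero: "orbit 0 = \<zero>\<^bsub>Ind\<^esub>"
  using orbit_add[of 0 0] orbit_closed[of 0] Ind.M.add.l_cancel_one[of "orbit 0" "orbit 0"] by simp

lemma orbit_diff: "orbit (a - b) = orbit a \<ominus>\<^bsub>Ind\<^esub> orbit b"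
proof -
  have "orbit (a - b) \<oplus>\<^bsub>Ind\<^esub> orbit b = orbit a" by (simp flip: orbit_add)
  then show ?thesis
    using orbit_closed by (metis Ind.M.a_assoc Ind.M.a_inv_closed Ind.M.r_neg Ind.M.r_zero a_minus_def)
qed

lemma Ind_eq_orbit:
  assumes "m \<in> carrier Ind" obtains a where "m = orbit a"
proof -
  have "\<exists>a. m = orbit a"
    using assms
  proof (induction rule: Ind_induct)
    case (tensor a x)
    then obtain b z where "a = cls q b" "x = hC q z \<odot>\<^bsub>V\<^esub> v"
      unfolding carrier_hecke V_eq by blast
    then show ?case using tensor_parabolic[OF parabolic_mem(3)] by blast
  qed (metis orbit_zero, metis orbit_diff)
  then show ?thesis using that by blast
qed

definition pbw :: "complex \<Rightarrow> complex \<Rightarrow> complex \<Rightarrow> complex \<Rightarrow> free_alg" where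
  "pbw a b c d = cst a + cst b * gT Node1 + cst c * (gT Node2 * gT Node1)
     + cst d * (gT Node1 * (gT Node2 * gT Node1))"

text \<open>The elements that are congruent to a linear combination of the four words. The next lemmas show that
  this set is a left ideal; as it contains \<open>1\<close>, it is everything.\<close>

definition pbw_span :: "free_alg set" where
  "pbw_span = {x. \<exists>a b c d. orbit x = orbit (pbw a b c d)}"

lemma pbw_span_cong: "orbit x = orbit y \<Longrightarrow> y \<in> pbw_span \<Longrightarrow> x \<in> pbw_span"
  by (simp add: pbw_span_def)

lemma pbw_span_add:
  assumes "x \<in> pbw_span" "y \<in> pbw_span" shows "x + y \<in> pbw_span"
proof -
  obtain a b c d a' b' c' d' where "orbit x = orbit (pbw a b c d)" "orbit y = orbit (pbw a' b' c' d')"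
    using assms by (auto simp: pbw_span_def)
  moreover have "pbw a b c d + pbw a' b' c' d' = pbw (a + a') (b + b') (c + c') (d + d')"
    by (simp add: pbw_def cst_add algebra_simps)
  ultimately have "orbit (x + y) = orbit (pbw (a + a') (b + b') (c + c') (d + d'))"
    by (metis orbit_add)
  then show ?thesis unfolding pbw_span_def by blast
qed

lemma pbw_span_cst:
  assumes "x \<in> pbw_span" shows "cst k * x \<in> pbw_span"
proof -
  obtain a b c d where "orbit x = orbit (pbw a b c d)"
    using assms by (auto simp: pbw_span_def)
  then have "orbit (cst k * x) = orbit (cst k * pbw a b c d)" by (rule orbit_mult_left)
  also have "cst k * pbw a b c d = pbw (k * a) (k * b) (k * c) (k * d)"
    by (simp add: pbw_def distrib_left flip: cst_mult mult.assoc)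
  finally show ?thesis unfolding pbw_span_def by blast
qed

lemma pbw_span_basis:
  "1 \<in> pbw_span" "gT Node1 \<in> pbw_span" "gT Node2 * gT Node1 \<in> pbw_span"
  "gT Node1 * (gT Node2 * gT Node1) \<in> pbw_span"
proof -
  have "pbw a b c d \<in> pbw_span" for a b c d unfolding pbw_span_def by blast
  from this[of 1 0 0 0] this[of 0 1 0 0] this[of 0 0 1 0] this[of 0 0 0 1]
  show "1 \<in> pbw_span" "gT Node1 \<in> pbw_span" "gT Node2 * gT Node1 \<in> pbw_span"
    "gT Node1 * (gT Node2 * gT Node1) \<in> pbw_span"
    by (simp_all add: pbw_def)
qed

lemma pbw_span_quadratic:
  assumes "x \<in> pbw_span" "gT i * x \<in> pbw_span"
  shows "gT i * (gT i * x) \<in> pbw_span"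
proof (rule pbw_span_cong)
  show "orbit (gT i * (gT i * x)) = orbit ((cst (q - inverse q) * gT i + 1) * x)"
    using orbit_mult_cls[OF quadratic_relation] by (simp add: mult.assoc)
  show "(cst (q - inverse q) * gT i + 1) * x \<in> pbw_span"
    using pbw_span_add[OF pbw_span_cst[OF assms(2)] assms(1)] by (simp add: distrib_right mult.assoc)
qed

text \<open>The quadratic relation shortens words with a repeated letter. The only new word
  is \<open>T\<^sub>2T\<^sub>1T\<^sub>2T\<^sub>1\<close>, which the braid relation turns into \<open>T\<^sub>1T\<^sub>2T\<^sub>1T\<^sub>2\<close>, and \<open>T\<^sub>2\<close> acts on \<open>v\<close> by \<open>q\<close>.\<close>

lemma pbw_span_T:
  assumes "x \<in> pbw_span" shows "gT i * x \<in> pbw_span"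
proof -
  have T2: "gT Node2 \<in> pbw_span"
    by (rule pbw_span_cong[OF orbit_T2[of 1, simplified]]) (use pbw_span_cst[OF pbw_span_basis(1)] in simp)
  have braid: "gT Node2 * (gT Node1 * (gT Node2 * gT Node1)) \<in> pbw_span"
  proof (rule pbw_span_cong)
    show "orbit (gT Node2 * (gT Node1 * (gT Node2 * gT Node1))) =
        orbit (cst q * (gT Node1 * (gT Node2 * gT Node1)))"
      using orbit_mult_cls[OF braid_relation, of 1] orbit_T2[of "gT Node1 * (gT Node2 * gT Node1)"]
      by (simp add: mult.assoc)
  qed (intro pbw_span_cst pbw_span_basis)
  have basis: "gT i \<in> pbw_span" "gT i * gT Node1 \<in> pbw_span" "gT i * (gT Node2 * gT Node1) \<in> pbw_span"
    "gT i * (gT Node1 * (gT Node2 * gT Node1)) \<in> pbw_span"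
    using pbw_span_basis T2 braid pbw_span_quadratic[of 1] pbw_span_quadratic[OF pbw_span_basis(2), of Node2]
      pbw_span_quadratic[OF pbw_span_basis(3), of Node1]
    by (cases i; simp)+
  obtain a b c d where "orbit x = orbit (pbw a b c d)"
    using assms by (auto simp: pbw_span_def)
  then have "orbit (gT i * x) = orbit (gT i * pbw a b c d)" by (rule orbit_mult_left)
  moreover have "gT i * (cst k * y) = cst k * (gT i * y)" for k y
    by (metis cst_commute mult.assoc)
  then have "gT i * pbw a b c d = cst a * gT i + cst b * (gT i * gT Node1)
      + cst c * (gT i * (gT Node2 * gT Node1)) + cst d * (gT i * (gT Node1 * (gT Node2 * gT Node1)))"
    by (simp add: pbw_def distrib_left cst_commute)
  then have "gT i * pbw a b c d \<in> pbw_span"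
    by (simp only:) (intro pbw_span_add pbw_span_cst basis)
  ultimately show ?thesis by (rule pbw_span_cong)
qed

text \<open>If all \<open>X\<^sup>\<nu>y\<close> lie in the span, then so do all \<open>X\<^sup>\<nu>T\<^sub>iy\<close>, since \<open>X\<^sup>\<nu>T\<^sub>i\<close> can be rewritten with the letters of \<open>X\<close> on the
  right of \<open>T\<^sub>i\<close>. Applied along the four words, this gives stability under \<open>X\<close>.\<close>

lemma pbw_span_X_T:
  assumes "\<And>\<nu>. gX \<nu> * y \<in> pbw_span"
  shows "gX \<nu> * (gT i * y) \<in> pbw_span"
proof -
  obtain f where f: "divided_difference i \<nu> f" using divided_difference_exists by blast
  have emb: "emb g * y \<in> pbw_span" for g
  proof (induction g rule: poly_mapping_additive_induct)
    case (single \<mu> c)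
    have "emb (Poly_Mapping.single \<mu> c) = cst c * gX \<mu>"
      by (simp add: emb_single cst_def gen_def mult_single plus_list_def)
    then show ?case using pbw_span_cst[OF assms] by (simp add: mult.assoc)
  next
    case (add f g)
    then show ?case using pbw_span_add by (simp add: emb_add distrib_right)
  qed
  have "(gT i * gX (simple_refl i \<nu>) + cst (q - inverse q) * emb f) * y \<in> pbw_span"
    using pbw_span_add[OF pbw_span_T[OF assms] pbw_span_cst[OF emb]] by (simp add: distrib_right mult.assoc)
  with orbit_mult_cls[OF bernstein_relation_hecke[OF f], of y] show ?thesis
    by (intro pbw_span_cong[of "gX \<nu> * (gT i * y)"]) (simp_all add: mult.assoc)
qed

lemma pbw_span_X:
  assumes "x \<in> pbw_span" shows "gX \<nu> * x \<in> pbw_span"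
proof -
  have X1: "gX \<nu> \<in> pbw_span" for \<nu>
    by (rule pbw_span_cong[OF orbit_X[of 1, simplified]]) (use pbw_span_cst[OF pbw_span_basis(1)] in simp)
  have X2: "gX \<nu> * gT Node1 \<in> pbw_span" for \<nu> using pbw_span_X_T[of 1 \<nu> Node1] X1 by simp
  have X3: "gX \<nu> * (gT Node2 * gT Node1) \<in> pbw_span" for \<nu> by (rule pbw_span_X_T[OF X2])
  have X4: "gX \<nu> * (gT Node1 * (gT Node2 * gT Node1)) \<in> pbw_span" for \<nu> by (rule pbw_span_X_T[OF X3])
  obtain a b c d where "orbit x = orbit (pbw a b c d)"
    using assms by (auto simp: pbw_span_def)
  then have "orbit (gX \<nu> * x) = orbit (gX \<nu> * pbw a b c d)" by (rule orbit_mult_left)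
  moreover have "gX \<nu> * (cst k * y) = cst k * (gX \<nu> * y)" for k y
    by (metis cst_commute mult.assoc)
  then have "gX \<nu> * pbw a b c d = cst a * gX \<nu> + cst b * (gX \<nu> * gT Node1)
      + cst c * (gX \<nu> * (gT Node2 * gT Node1)) + cst d * (gX \<nu> * (gT Node1 * (gT Node2 * gT Node1)))"
    by (simp add: pbw_def distrib_left cst_commute)
  then have "gX \<nu> * pbw a b c d \<in> pbw_span"
    by (simp only:) (intro pbw_span_add pbw_span_cst X1 X2 X3 X4)
  ultimately show ?thesis by (rule pbw_span_cong)
qed

lemma orbit_eq_pbw: obtains a b c d where "orbit x = orbit (pbw a b c d)"
proof -
  have word: "Poly_Mapping.single w k \<in> pbw_span" for w k
  proof (induction w)
    case Nil
    show ?case using pbw_span_cst[OF pbw_span_basis(1), of k] by (simp add: cst_def)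
  next
    case (Cons g w)
    have "Poly_Mapping.single (g # w) k = gen g * Poly_Mapping.single w k"
      by (simp add: gen_def mult_single plus_list_def)
    then show ?case using Cons pbw_span_T pbw_span_X by (cases g) simp_all
  qed
  have "x \<in> pbw_span"
    by (induction x rule: poly_mapping_additive_induct) (use word pbw_span_add in auto)
  then show ?thesis using that unfolding pbw_span_def by blast
qed

lemma scalar_inj:
  assumes "hC q z \<odot>\<^bsub>V\<^esub> v = hC q z' \<odot>\<^bsub>V\<^esub> v" shows "z = z'"
proof (rule ccontr)
  assume "z \<noteq> z'"
  have closed: "hC q c \<odot>\<^bsub>V\<^esub> v \<in> carrier V" for c
    by (rule parabolic_smult(1)[OF parabolic_mem(3) parabolic_mem(3) v_closed])
  have "hC q (z - z') \<odot>\<^bsub>V\<^esub> v \<oplus>\<^bsub>V\<^esub> hC q z' \<odot>\<^bsub>V\<^esub> v = hC q z' \<odot>\<^bsub>V\<^esub> v"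
    using assms by (simp flip: scalar_add)
  then have 0: "hC q (z - z') \<odot>\<^bsub>V\<^esub> v = \<zero>\<^bsub>V\<^esub>"
    using V.M.add.r_cancel_one closed by metis
  have "v = hC q (inverse (z - z')) \<odot>\<^bsub>V\<^esub> (hC q (z - z') \<odot>\<^bsub>V\<^esub> v)"
    using \<open>z \<noteq> z'\<close> scalar_one by (simp flip: scalar_mult)
  with 0 v_nonzero V.smult_r_null show False by (simp add: parabolic_operations parabolic_mem)
qed

text \<open>The inclusion of \<open>\<complex>v\<close> into \<open>\<complex>\<^sup>4\<close> as the first coordinate axis.\<close>

definition coord :: "'v \<Rightarrow> vec4" where
  "coord x = (THE z. x = hC q z \<odot>\<^bsub>V\<^esub> v, 0, 0, 0)"

lemma coord_scalar: "coord (hC q z \<odot>\<^bsub>V\<^esub> v) = (z, 0, 0, 0)"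
  unfolding coord_def using scalar_inj by (auto intro: the_equality)

lemma coord_add:
  assumes "x \<in> carrier V" "y \<in> carrier V"
  shows "coord (x \<oplus>\<^bsub>V\<^esub> y) = coord x + coord y"
proof -
  obtain z1 z2 where z: "x = hC q z1 \<odot>\<^bsub>V\<^esub> v" "y = hC q z2 \<odot>\<^bsub>V\<^esub> v"
    using assms V_eq by blast
  show ?thesis unfolding z scalar_add[symmetric] coord_scalar by simp
qed

lemma coord_eigen:
  assumes "cls q a \<in> parabolic_carrier q Node2" "cls q a \<odot>\<^bsub>V\<^esub> v = hC q c \<odot>\<^bsub>V\<^esub> v"
    and "\<And>z. rep4.alg_act a (z, 0, 0, 0) = (z * c, 0, 0, 0)" and "x \<in> carrier V"
  shows "coord (cls q a \<odot>\<^bsub>V\<^esub> x) = rep4.hecke_act q (cls q a) (coord x)"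
proof -
  obtain z where x: "x = hC q z \<odot>\<^bsub>V\<^esub> v" using assms(4) V_eq by blast
  have "cls q a \<odot>\<^bsub>V\<^esub> x = (hC q z \<otimes>\<^bsub>hecke q\<^esub> cls q a) \<odot>\<^bsub>V\<^esub> v"
    using parabolic_smult(3)[OF assms(1) parabolic_mem(3) v_closed, of z]
    by (simp add: x cls_mult cst_commute)
  also have "\<dots> = hC q (z * c) \<odot>\<^bsub>V\<^esub> v"
    using parabolic_smult(3)[OF parabolic_mem(3) assms(1) v_closed, of z] by (simp add: assms(2) scalar_mult)
  finally show ?thesis
    using assms(3) by (simp add: x coord_scalar rep4_act_cls)
qed

text \<open>The inclusion is linear over the parabolic subalgebra because the first basis vector of the model is an
  eigenvector of \<open>T\<^sub>2\<close> and of all \<open>X\<^sup>\<nu>\<close> with the same eigenvalues as \<open>v\<close>; the elements for which linearity holds form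
  a subring.\<close>

lemma coord_smult:
  assumes "s \<in> parabolic_carrier q Node2" "x \<in> carrier V"
  shows "coord (s \<odot>\<^bsub>V\<^esub> x) = rep4.hecke_act q s (coord x)"
proof -
  have rep: "\<exists>a. s = cls q a" if "s \<in> parabolic_carrier q Node2" for s
    using that S_sub unfolding carrier_hecke parabolic_operations by blast
  have mult: "coord ((r \<otimes>\<^bsub>hecke q\<^esub> s) \<odot>\<^bsub>V\<^esub> x) = rep4.hecke_act q (r \<otimes>\<^bsub>hecke q\<^esub> s) (coord x)"
    if rs: "r \<in> parabolic_carrier q Node2" "s \<in> parabolic_carrier q Node2" and x: "x \<in> carrier V"
      and r: "\<And>x. x \<in> carrier V \<Longrightarrow> coord (r \<odot>\<^bsub>V\<^esub> x) = rep4.hecke_act q r (coord x)"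
      and s: "coord (s \<odot>\<^bsub>V\<^esub> x) = rep4.hecke_act q s (coord x)" for r s x
  proof -
    obtain a b where ab: "r = cls q a" "s = cls q b" using rep rs by meson
    show ?thesis
      using r[OF parabolic_smult(1)[OF rs x]] s unfolding parabolic_smult(3)[OF rs x]
      by (simp add: ab cls_mult rep4_act_cls rep4.alg_act_mult)
  qed
  have scalar: "coord (hC q c \<odot>\<^bsub>V\<^esub> x) = rep4.hecke_act q (hC q c) (coord x)" if "x \<in> carrier V" for c x
    using that parabolic_mem(3) by (intro coord_eigen) auto
  show ?thesis
    using assms unfolding parabolic_carrier_def
  proof (induction arbitrary: x rule: generate_ring.induct)
    case one
    then show ?case
      using parabolic_smult(4)[OF parabolic_mem(3) parabolic_mem(3)] by (simp add: cls_one rep4_act_cls)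
  next
    case (incl h)
    then consider "h = hT q Node2" | \<nu> where "h = hX q \<nu>" | c where "h = hC q c" by blast
    then show ?case
    proof cases
      case 1
      show ?thesis unfolding 1 using parabolic_mem(1) T2_v \<open>x \<in> carrier V\<close> by (intro coord_eigen) auto
    next
      case 2
      show ?thesis unfolding 2 using parabolic_mem(2) X_v \<open>x \<in> carrier V\<close> by (intro coord_eigen) auto
    next
      case 3
      then show ?thesis using scalar \<open>x \<in> carrier V\<close> by simp
    qed
  next
    case (a_inv h)
    have h: "h \<in> parabolic_carrier q Node2"
      using a_inv(1) by (simp add: parabolic_carrier_def)
    then obtain a where a: "h = cls q a" using rep by meson
    have "\<ominus>\<^bsub>hecke q\<^esub> h = hC q (-1) \<otimes>\<^bsub>hecke q\<^esub> h"
    proof (rule R.minus_equality)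
      have "cst (-1) * a + a = (cst (-1) + cst 1) * a" by (simp add: distrib_right)
      also have "\<dots> = 0" by (simp only: flip: cst_add) simp
      finally show "hC q (-1) \<otimes>\<^bsub>hecke q\<^esub> h \<oplus>\<^bsub>hecke q\<^esub> h = \<zero>\<^bsub>hecke q\<^esub>"
        by (simp add: a cls_mult cls_add cls_zero)
    qed (simp_all add: a cls_mult cls_carrier)
    then show ?case
      using mult[OF parabolic_mem(3) h a_inv.prems scalar a_inv.IH[OF a_inv.prems]] by simp
  next
    case (eng_add h1 h2)
    have h: "h1 \<in> parabolic_carrier q Node2" "h2 \<in> parabolic_carrier q Node2"
      using eng_add(1,2) by (simp_all add: parabolic_carrier_def)
    obtain a b where ab: "h1 = cls q a" "h2 = cls q b" using rep h by meson
    have "coord ((h1 \<oplus>\<^bsub>hecke q\<^esub> h2) \<odot>\<^bsub>V\<^esub> x) = coord (h1 \<odot>\<^bsub>V\<^esub> x) + coord (h2 \<odot>\<^bsub>V\<^esub> x)"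
      unfolding parabolic_smult(2)[OF h eng_add.prems]
      by (intro coord_add parabolic_smult(1)[OF h(1)] h eng_add.prems)
    then show ?case
      unfolding eng_add.IH[OF eng_add.prems] by (simp only: ab cls_add rep4_act_cls rep4.alg_act_plus)
  next
    case (eng_mult h1 h2)
    have h: "h1 \<in> parabolic_carrier q Node2" "h2 \<in> parabolic_carrier q Node2"
      using eng_mult(1,2) by (simp_all add: parabolic_carrier_def)
    show ?case by (rule mult[OF h eng_mult.prems eng_mult.IH(1) eng_mult.IH(2)[OF eng_mult.prems]])
  qed
qed

text \<open>Injectivity: the four words send the first basis vector to \<open>(1, 0, 0, 0)\<close>, \<open>(0, 1, 0, 0)\<close>, \<open>(2, q, 1, 0)\<close> and
  \<open>(q, 2 + \<delta>q, q, 1)\<close>. These are linearly independent by triangularity.\<close>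

lemma coordinates_exist:
  obtains \<Phi> where
    "\<And>A B. A \<in> carrier Ind \<Longrightarrow> B \<in> carrier Ind \<Longrightarrow> \<Phi> (A \<oplus>\<^bsub>Ind\<^esub> B) = \<Phi> A + \<Phi> B"
    "\<And>a A. A \<in> carrier Ind \<Longrightarrow> \<Phi> (cls q a \<odot>\<^bsub>Ind\<^esub> A) = rep4.alg_act a (\<Phi> A)"
    "inj_on \<Phi> (carrier Ind)" "\<Phi> (orbit 1) = (1, 0, 0, 0)"
proof -
  obtain \<Phi> where add: "\<And>A B. A \<in> carrier Ind \<Longrightarrow> B \<in> carrier Ind \<Longrightarrow> \<Phi> (A \<oplus>\<^bsub>Ind\<^esub> B) = \<Phi> A + \<Phi> B"
    and smult: "\<And>r A. r \<in> carrier (hecke q) \<Longrightarrow> A \<in> carrier Ind \<Longrightarrow>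
        \<Phi> (r \<odot>\<^bsub>Ind\<^esub> A) = rep4.hecke_act q r (\<Phi> A)"
    and tensor: "\<And>a x. a \<in> carrier (hecke q) \<Longrightarrow> x \<in> carrier V \<Longrightarrow>
        \<Phi> (tensor a x) = rep4.hecke_act q a (coord x)"
  proof (rule induced_hom_exists[of "rep4.hecke_act q" coord])
    fix a b x assume "a \<in> carrier (hecke q)" "b \<in> carrier (hecke q)"
    then obtain a' b' where ab: "a = cls q a'" "b = cls q b'" unfolding carrier_hecke by blast
    show "rep4.hecke_act q (a \<oplus>\<^bsub>hecke q\<^esub> b) x = rep4.hecke_act q a x + rep4.hecke_act q b x"
      by (simp only: ab cls_add rep4_act_cls rep4.alg_act_plus)
    show "rep4.hecke_act q (a \<otimes>\<^bsub>hecke q\<^esub> b) x = rep4.hecke_act q a (rep4.hecke_act q b x)"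
      by (simp only: ab cls_mult rep4_act_cls rep4.alg_act_mult)
  next
    fix a x y assume "a \<in> carrier (hecke q)"
    then obtain a' where "a = cls q a'" unfolding carrier_hecke by blast
    then show "rep4.hecke_act q a (x + y) = rep4.hecke_act q a x + rep4.hecke_act q a y"
      by (simp only: rep4_act_cls rep4.alg_act_add)
  qed (auto simp: coord_add coord_smult parabolic_operations)
  have coord_v: "coord v = (1, 0, 0, 0)" using coord_scalar[of 1] by (simp only: scalar_one)
  have orbit: "\<Phi> (orbit a) = rep4.alg_act a (1, 0, 0, 0)" for a
    unfolding orbit_def tensor[OF cls_carrier v_closed] rep4_act_cls coord_v ..
  have pbw: "\<Phi> (orbit (pbw a b c d)) =
      (a + 2 * c + q * d, b + q * c + (2 + (q - inverse q) * q) * d, c + q * d, d)" for a b c d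
    by (simp add: orbit pbw_def rep4.alg_act_plus rep4.alg_act_mult algebra_simps)
  have "inj_on \<Phi> (carrier Ind)"
  proof (rule inj_onI)
    fix x y assume xy: "x \<in> carrier Ind" "y \<in> carrier Ind" "\<Phi> x = \<Phi> y"
    then obtain a b c d a' b' c' d' where e: "x = orbit (pbw a b c d)" "y = orbit (pbw a' b' c' d')"
      by (metis Ind_eq_orbit orbit_eq_pbw)
    then have "d = d'" "c = c'" "b = b'" "a = a'" using xy(3) by (auto simp: pbw)
    with e show "x = y" by simp
  qed
  moreover have "\<Phi> (cls q a \<odot>\<^bsub>Ind\<^esub> A) = rep4.alg_act a (\<Phi> A)" if "A \<in> carrier Ind" for a A
    using smult[OF cls_carrier that] by (simp only: rep4_act_cls)
  ultimately show ?thesis using that add orbit[of 1] by (metis rep4.alg_act_one)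
qed

text \<open>In coordinates the weight space of \<open>s\<^sub>1s\<^sub>2t\<close> is the last axis: \<open>X\<^bsup>\<alpha>\<^sub>1\<^esup>\<close> acts there by \<open>q\<^sup>-\<^sup>2\<close>, while its eigenvalues on
  the first three coordinates are \<open>1\<close> and \<open>q\<^sup>2\<close>. So it is the kernel of the projection to the
  irreducible three-dimensional quotient.\<close>

lemma quotient_by_weight_space_irreducible:
  assumes \<mu>: "\<mu> = weyl_act (simple_refl Node1 \<circ> simple_refl Node2) t"
  shows "submodule (weight_space q Ind \<mu>) (hecke q) Ind"
    and "irreducible_module (hecke q) (quot_module Ind (weight_space q Ind \<mu>))"
proof -
  have "inv_into UNIV (simple_refl Node1 \<circ> simple_refl Node2) = simple_refl Node2 \<circ> simple_refl Node1"
    by (rule inv_equality) simp_all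
  then have \<mu>_eq: "\<mu> \<nu> = t (simple_refl Node2 (simple_refl Node1 \<nu>))" for \<nu>
    by (simp add: \<mu> weyl_act_def)
  obtain \<Phi> where
    add: "\<And>A B. A \<in> carrier Ind \<Longrightarrow> B \<in> carrier Ind \<Longrightarrow> \<Phi> (A \<oplus>\<^bsub>Ind\<^esub> B) = \<Phi> A + \<Phi> B"
    and smult: "\<And>a A. A \<in> carrier Ind \<Longrightarrow> \<Phi> (cls q a \<odot>\<^bsub>Ind\<^esub> A) = rep4.alg_act a (\<Phi> A)"
    and inj: "inj_on \<Phi> (carrier Ind)" and one: "\<Phi> (orbit 1) = (1, 0, 0, 0)"
    using coordinates_exist by blast
  define \<phi> where "\<phi> = drop_last \<circ> \<Phi>"
  have phi_add: "\<phi> (A \<oplus>\<^bsub>Ind\<^esub> B) = \<phi> A + \<phi> B" if "A \<in> carrier Ind" "B \<in> carrier Ind" for A B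
    using add[OF that] by (simp add: \<phi>_def drop_last_add)
  have phi_smult: "\<phi> (r \<odot>\<^bsub>Ind\<^esub> A) = rep3.hecke_act q r (\<phi> A)"
    if "r \<in> carrier (hecke q)" "A \<in> carrier Ind" for r A
  proof -
    obtain a where "r = cls q a" using \<open>r \<in> carrier (hecke q)\<close> unfolding carrier_hecke by blast
    then show ?thesis using smult[OF that(2)] by (simp add: \<phi>_def drop_last_alg_act rep3_act_cls)
  qed
  have rho_zero: "rep3.hecke_act q r 0 = 0" for r
    by (simp add: rep3.hecke_act_def)
  have weight_space: "weight_space q Ind \<mu> = {m \<in> carrier Ind. \<phi> m = 0}"
  proof (intro equalityI subsetI)
    fix m assume "m \<in> weight_space q Ind \<mu>"
    then have m: "m \<in> carrier Ind" "hX q (2, -1) \<odot>\<^bsub>Ind\<^esub> m = hC q (\<mu> (2, -1)) \<odot>\<^bsub>Ind\<^esub> m"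
      by (auto simp: weight_space_def)
    obtain x y z w where xyz: "\<Phi> m = (x, y, z, w)" by (metis prod_cases4)
    have \<mu>_root: "\<mu> (2, -1) = inverse (q\<^sup>2)"
      by (simp add: \<mu>_eq simple_refl_def scale_def t_values power_inverse)
    have "rep4 q t (GenX (2, -1)) (x, y, z, w) = scale4 (\<mu> (2, -1)) (x, y, z, w)"
      using smult[OF m(1)] m(2) by (metis xyz rep4.alg_act_gen rep4.alg_act_cst)
    then have eq: "x + (q - inverse q) * 2 * y = inverse (q\<^sup>2) * x" "y = inverse (q\<^sup>2) * y" "q\<^sup>2 * z = inverse (q\<^sup>2) * z"
      unfolding \<mu>_root by (simp_all add: t_simple_root simple_refl_def scale_def)
    have neq: "inverse (q\<^sup>2) \<noteq> 1" "inverse (q\<^sup>2) \<noteq> q\<^sup>2"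
    proof -
      show "inverse (q\<^sup>2) \<noteq> 1" using q2_neq_1 by simp
      show "inverse (q\<^sup>2) \<noteq> q\<^sup>2"
      proof
        assume "inverse (q\<^sup>2) = q\<^sup>2"
        then have "q\<^sup>2 * q\<^sup>2 = 1" using q_nonzero by (metis right_inverse power_not_zero)
        then show False using q2_neq_1 q2_neq_m1 square_eq_1_iff by blast
      qed
    qed
    have "y = 0" using eq(2) neq(1) by (metis mult_cancel_right2)
    moreover have "z = 0" using eq(3) neq(2) by (metis mult_cancel_right)
    moreover have "x = 0" using eq(1) neq(1) \<open>y = 0\<close> by (metis add_0_right mult_cancel_right2 mult_zero_right)
    ultimately show "m \<in> {m \<in> carrier Ind. \<phi> m = 0}"
      using m(1) xyz by (simp add: \<phi>_def zero_prod_def)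
  next
    fix m assume "m \<in> {m \<in> carrier Ind. \<phi> m = 0}"
    then have m: "m \<in> carrier Ind" "\<phi> m = 0" by auto
    obtain x y z w where xyz: "\<Phi> m = (x, y, z, w)" by (metis prod_cases4)
    then have w: "\<Phi> m = (0, 0, 0, w)" using m(2) by (simp add: \<phi>_def zero_prod_def)
    have "hX q \<nu> \<odot>\<^bsub>Ind\<^esub> m = hC q (\<mu> \<nu>) \<odot>\<^bsub>Ind\<^esub> m" for \<nu>
    proof (rule inj_onD[OF inj])
      show "\<Phi> (hX q \<nu> \<odot>\<^bsub>Ind\<^esub> m) = \<Phi> (hC q (\<mu> \<nu>) \<odot>\<^bsub>Ind\<^esub> m)"
        unfolding smult[OF m(1)] w by (simp add: \<mu>_eq)
    qed (use m cls_carrier in auto)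
    then show "m \<in> weight_space q Ind \<mu>" using m(1) by (simp add: weight_space_def)
  qed
  show "submodule (weight_space q Ind \<mu>) (hecke q) Ind"
    unfolding weight_space
    by (rule left_module_kernel_submodule[OF Ind.left_module_axioms phi_add phi_smult rho_zero])
  show "irreducible_module (hecke q) (quot_module Ind (weight_space q Ind \<mu>))"
    unfolding weight_space
  proof (rule irreducible_quotient_by_kernel[OF Ind.left_module_axioms phi_add phi_smult rho_zero orbit_closed[of 1]])
    show "\<phi> (orbit 1) \<noteq> 0" by (simp add: \<phi>_def one zero_prod_def)
    fix D x assume add_D: "\<And>x y. x \<in> D \<Longrightarrow> y \<in> D \<Longrightarrow> x + y \<in> D"
      and smult_D: "\<And>r x. r \<in> carrier (hecke q) \<Longrightarrow> x \<in> D \<Longrightarrow> rep3.hecke_act q r x \<in> D"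
      and x: "x \<in> D" "x \<noteq> 0"
    have act_D: "rep3.alg_act a x \<in> D" if "x \<in> D" for a x
      using smult_D[OF cls_carrier that] by (simp only: rep3_act_cls)
    show "D = UNIV"
      using act_D[of _ "gen _"] act_D[of _ "cst _"] add_D x
      by (intro rep3_irreducible[of D x]) simp_all
  qed
qed

end

text \<open>The relations involve the parameter only through \<open>q - q\<^sup>-\<^sup>1\<close>.\<close>

lemma hecke_neg_inverse: "hecke_ideal (- inverse q) = hecke_ideal q"
proof -
  have "- inverse q - inverse (- inverse q) = q - inverse q" by simp
  then have "hecke_relations (- inverse q) = hecke_relations q"
    unfolding hecke_relations_def by simp
  then show ?thesis unfolding hecke_ideal_def by simp
qed

theorem proposition20:
  fixes q :: complex and t :: "weight \<Rightarrow> complex"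
    and V :: "(free_alg set, 'v) module" and v :: 'v
    and U :: "(free_alg set, 'u) module" and u :: 'u
    and M :: "(free_alg set, (free_alg set \<times> 'v \<Rightarrow>\<^sub>0 int) set) module"
    and N :: "(free_alg set, (free_alg set \<times> 'u \<Rightarrow>\<^sub>0 int) set) module"
  assumes "q \<noteq> 0" and "q\<^sup>2 \<noteq> 1" and "q\<^sup>2 \<noteq> -1"
    and "t \<in> characters" and "restricts_to t 1 (q\<^sup>2)"
    and "is_line_module q Node2 V v q t"
    and "is_line_module q Node2 U u (- inverse q) (weyl_act longest_elt t)"
    and "M = induced_module (hecke q) (parabolic q Node2) V"
    and "N = induced_module (hecke q) (parabolic q Node2) U"
  shows "submodule (weight_space q M (weyl_act (simple_refl Node1 \<circ> simple_refl Node2) t)) (hecke q) M \<and>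
    irreducible_module (hecke q)
      (quot_module M (weight_space q M (weyl_act (simple_refl Node1 \<circ> simple_refl Node2) t))) \<and>
    submodule (weight_space q N (weyl_act (simple_refl Node2) t)) (hecke q) N \<and>
    irreducible_module (hecke q)
      (quot_module N (weight_space q N (weyl_act (simple_refl Node2) t)))"
proof -
  interpret M: line_module q t V v
    using assms by unfold_locales
  define q' where "q' = - inverse q"
  define t' where "t' = weyl_act longest_elt t"
  have "inv_into UNIV longest_elt = longest_elt" by (rule inv_equality) (simp_all add: longest_elt_uminus)
  then have t'_eq: "t' \<nu> = t (- \<nu>)" for \<nu> by (simp add: t'_def weyl_act_def longest_elt_uminus)
  have cls: "cls q' = cls q" and hecke: "hecke q' = hecke q"
    unfolding q'_def cls_def hecke_def hecke_neg_inverse by simp_all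
  have par: "parabolic q' i = parabolic q i" for i
    by (simp add: parabolic_def parabolic_carrier_def cls hecke)
  have wsp: "weight_space q' = weight_space q"
    by (intro ext) (simp add: weight_space_def cls)
  \<comment> \<open>The module \<open>U\<close> is a line on which \<open>T\<^sub>2\<close> acts by the new parameter \<open>q'\<close>, and \<open>w\<^sub>0t\<close> restricts to \<open>(1, q'\<^sup>2)\<close>.\<close>
  interpret N: line_module q' t' U u
  proof
    have q'2: "q'\<^sup>2 = inverse (q\<^sup>2)" by (simp add: q'_def power_inverse)
    show "q' \<noteq> 0" using assms(1) by (simp add: q'_def)
    show "q'\<^sup>2 \<noteq> 1" "q'\<^sup>2 \<noteq> - 1"
      unfolding q'2 using assms(2,3) by (metis inverse_inverse_eq inverse_minus_eq inverse_1)+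
    show "t' \<in> characters"
      unfolding characters_def mem_Collect_eq t'_eq minus_add_distrib using M.t_add M.t_nonzero by blast
    show "restricts_to t' 1 (q'\<^sup>2)"
      using assms(5) unfolding restricts_to_def t'_eq M.t_uminus q'2
      by (simp add: power_int_inverse)
    show "is_line_module q' Node2 U u q' t'"
      using assms(7)[folded q'_def t'_def] unfolding is_line_module_def par cls .
  qed
  have "weyl_act (simple_refl Node1 \<circ> simple_refl Node2) t' = weyl_act (simple_refl Node2) t"
  proof
    fix \<nu> :: weight
    obtain a b where \<nu>: "\<nu> = (a, b)" by (cases \<nu>)
    have inv: "inv_into UNIV (simple_refl Node1 \<circ> simple_refl Node2) = simple_refl Node2 \<circ> simple_refl Node1"
      "inv_into UNIV (simple_refl Node2) = simple_refl Node2"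
      by (rule inv_equality; simp)+
    have "- simple_refl Node2 (simple_refl Node1 \<nu>) =
        simple_refl Node2 \<nu> + scale (- a - 2 * b) (simple_root Node1)"
      by (simp add: \<nu> simple_refl_def scale_def algebra_simps)
    moreover have "t (scale (- a - 2 * b) (simple_root Node1)) = 1"
      using M.t_Q[unfolded restricts_to_def, rule_format, of "- a - 2 * b" 0]
      by (simp add: scale_def)
    ultimately show "weyl_act (simple_refl Node1 \<circ> simple_refl Node2) t' \<nu> = weyl_act (simple_refl Node2) t \<nu>"
      by (simp add: weyl_act_def inv t'_eq M.t_add)
  qed
  then show ?thesis
    using M.quotient_by_weight_space_irreducible[OF refl] N.quotient_by_weight_space_irreducible[OF refl]
    by (simp only: assms(8,9) hecke par wsp simp_thms)
qed

end
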